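(* Let $W$ be of type $\widehat{SL}_2$ with double affine Weyl semigroup $W_{\mathcal T}$. Then the generalised Demazure product on $W_{\mathcal T}$ is well-defined for non-zero level and associative for level greater than one. That is: (a) for all $x,y\in W_{\mathcal T}$ with $\mathrm{lev}(x)\neq0$ and $\mathrm{lev}(y)\ne 0$, the element $x*_{u,v}^p y$ does not depend on the choice of $(u,v)\in M_{x,y}$ nor on the choice of shortest path $p$ from $u$ to $w_yv$ in $\mathrm{QBG}(W)$ (denote it $x*y$); (b) for all $x,y,z\in W_{\mathcal T}$ of level greater than one, $(x*y)*z=x*(y*z)$.
   Context: Type $\widehat{SL}_2$. Let $\alpha$ be the positive root of $SL_2$ with coroot $\alpha^\vee$, $\langle\alpha,\alpha^\vee\rangle=2$. The (real affine) roots are $\Phi=\{\pm\alpha+n\delta: n\in\mathbb Z\}$, the positive roots are $\Phi^+=\{\alpha+n\delta:n\ge 0\}\cup\{-\alpha+n\delta:n\ge 1\}$, and the simple roots are $\tilde\alpha_1=\alpha$, $\tilde\alpha_0=-\alpha+\delta$. The coweight lattice is $P^\vee=\mathbb Z\alpha^\vee\oplus\mathbb Z\delta\oplus\mathbb Z\Lambda_0$, with pairing $\langle \pm\alpha+n\delta,\ k\alpha^\vee+m\delta+l\Lambda_0\rangle=\pm 2k+nl$. The coroot of $\beta=\pm\alpha+n\delta$ is $\beta^\vee=\pm\alpha^\vee+n\delta\in P^\vee$, and the reflection $s_\beta$ acts on $P^\vee$ by $s_\beta(\mu)=\mu-\langle\beta,\mu\rangle\beta^\vee$. The Weyl group is $W=\langle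 s_0,s_1\mid s_0^2=s_1^2=e\rangle$ (infinite dihedral), $s_i=s_{\tilde\alpha_i}$, with word length $\ell$. Every element of $W$ is uniquely $w_0\tau^{r\alpha^\vee}$ with $w_0\in W_{\mathrm{fin}}=\{e,s_1\}$, $r\in\mathbb Z$, where $s_0=s_1\tau^{-\alpha^\vee}$; it acts on $\Phi$ by $w_0\tau^{r\alpha^\vee}(\pm\alpha+n\delta)=\pm w_0\alpha+(n\mp 2r)\delta$. The Tits cone is $\mathcal T=\{k\alpha^\vee+m\delta+l\Lambda_0: k,m\in\mathbb Z,\ l\in\mathbb Z_{>0}\}\cup\mathbb Z\delta$, and $W_{\mathcal T}=W\ltimes\mathcal T$, with elements $w\varepsilon^\mu$ ($w\in W,\mu\in\mathcal T$) and product $(w\varepsilon^\mu)(w'\varepsilon^{\mu'})=ww'\varepsilon^{w'^{-1}\mu+\mu'}$. The level of $x=w\varepsilon^{\mu}$, $\mu=k\alpha^\vee+m\delta+l\Lambda_0$, is $\mathrm{lev}(x)=l$. Quantum Bruhat graph: the directed weighted graph $\mathrm{QBG}(W)$ has vertex set $W$ and an edge $w\to ws_\beta$ ($\beta\in\Phi^+$) if either (Bruhat edge, weight $0$) $\ell(ws_\beta)=\ell(w)+1$, or (quantum edge, weight $\beta^\vee$) $\ell(ws_\beta)=\ell(w)+1-\langle 2\rho,\beta^\vee\rangle$, where $\langle 2\rho,\tilde\alpha_0^\vee\rangle=\langle 2\rho,\tilde\alpha_1^\vee\rangle=2$ (extended linearly). The length of a path is its number of edges, its weight $\mathrm{wt}(p)$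 is the sum of the weights of its edges, and $d(u\Rightarrow v)$ is the length of a shortest path from $u$ to $v$. Length positivity: for $\beta\in\Phi$ let $\Phi^+(\beta)=1$ if $\beta\in\Phi^+$ and $0$ otherwise. For $x=w\varepsilon^\mu$ put $\ell(x,\beta)=\langle\beta,\mu\rangle+\Phi^+(\beta)-\Phi^+(w\beta)$, and $\mathrm{LP}(x)=\{v\in W:\ell(x,v\beta)\ge 0\ \text{for all }\beta\in\Phi^+\}$. Generalised Demazure product: for $x=w_x\varepsilon^{\mu_x}$, $y=w_y\varepsilon^{\mu_y}$ in $W_{\mathcal T}$, let $M_{x,y}$ be the set of pairs $(u,v)\in\mathrm{LP}(x)\times\mathrm{LP}(y)$ with $d(u\Rightarrow w_yv)\le d(u'\Rightarrow w_yv')$ for all $(u',v')\in\mathrm{LP}(x)\times\mathrm{LP}(y)$. For $(u,v)\in M_{x,y}$ and a shortest path $p$ from $u$ to $w_yv$ in $\mathrm{QBG}(W)$, set $x*_{u,v}^p y=w_xuv^{-1}\varepsilon^{vu^{-1}\mu_x+\mu_y-v\,\mathrm{wt}(p)}$. *)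

theory Defs
  imports Main "HOL-Library.Product_Plus"
begin

section \<open>Roots and coweights\<close>

text \<open>\<open>APlus n\<close> is \<open>\<alpha> + n\<delta>\<close> and \<open>AMinus n\<close> is \<open>-\<alpha> + n\<delta>\<close>, so the type of roots is \<open>\<Phi>\<close>.\<close>

datatype root = APlus int | AMinus int

definition pos_roots :: "root set" where
  "pos_roots = {APlus n |n. n \<ge> 0} \<union> {AMinus n |n. n \<ge> 1}"

definition alpha1 :: root where "alpha1 = APlus 0"
definition alpha0 :: root where "alpha0 = AMinus 1"

text \<open>The triple \<open>(k, m, l)\<close> is the coweight \<open>k\<alpha>\<^sup>\<or> + m\<delta> + l\<Lambda>\<^sub>0\<close>; addition is componentwise.\<close>

type_synonym coweight = "int \<times> int \<times> int"

fun pairing :: "root \<Rightarrow> coweight \<Rightarrow> int" where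
  "pairing (APlus n) (k, m, l) = 2 * k + n * l"
| "pairing (AMinus n) (k, m, l) = - 2 * k + n * l"

fun coroot :: "root \<Rightarrow> coweight" where
  "coroot (APlus n) = (1, n, 0)"
| "coroot (AMinus n) = (-1, n, 0)"

fun cw_scale :: "int \<Rightarrow> coweight \<Rightarrow> coweight" where
  "cw_scale c (k, m, l) = (c * k, c * m, c * l)"

definition reflection :: "root \<Rightarrow> coweight \<Rightarrow> coweight" where
  "reflection \<beta> \<mu> = \<mu> - cw_scale (pairing \<beta> \<mu>) (coroot \<beta>)"

text \<open>
  The linear extension of \<open>\<langle>2\<rho>, \<alpha>\<^sub>0\<^sup>\<or>\<rangle> = \<langle>2\<rho>, \<alpha>\<^sub>1\<^sup>\<or>\<rangle> = 2\<close> to the span of the simple coroots: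
  \<open>k\<alpha>\<^sup>\<or> + m\<delta> = (k + m)\<alpha>\<^sub>1\<^sup>\<or> + m\<alpha>\<^sub>0\<^sup>\<or>\<close>. It is only ever evaluated on coroots, whose
  \<open>\<Lambda>\<^sub>0\<close>-component vanishes.
\<close>

fun two_rho :: "coweight \<Rightarrow> int" where
  "two_rho (k, m, l) = 2 * (k + m) + 2 * m"

section \<open>The Weyl group\<close>

text \<open>
  The infinite dihedral group, by normal forms: \<open>Tau r\<close> is \<open>\<tau>\<^bsup>r\<alpha>\<^sup>\<or>\<^esup>\<close> and \<open>STau r\<close> is
  \<open>s\<^sub>1\<tau>\<^bsup>r\<alpha>\<^sup>\<or>\<^esup>\<close>. The lemmas \<open>weyl_generated\<close> and \<open>weyl_presentation\<close> below show that this is the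
  group presented by \<open>\<langle>s\<^sub>0, s\<^sub>1 | s\<^sub>0\<^sup>2 = s\<^sub>1\<^sup>2 = e\<rangle>\<close>.
\<close>

datatype weyl = Tau int | STau int

instantiation weyl :: "{monoid_mult, inverse}"
begin

definition one_weyl :: weyl where "1 = Tau 0"

fun times_weyl :: "weyl \<Rightarrow> weyl \<Rightarrow> weyl" where
  "Tau r * Tau q = Tau (r + q)"
| "Tau r * STau q = STau (q - r)"
| "STau r * Tau q = STau (r + q)"
| "STau r * STau q = Tau (q - r)"

fun inverse_weyl :: "weyl \<Rightarrow> weyl" where
  "inverse (Tau r) = Tau (- r)"
| "inverse (STau r) = STau r"

definition divide_weyl :: "weyl \<Rightarrow> weyl \<Rightarrow> weyl" where
  "v div w = v * inverse w" for v w :: weyl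

instance
proof
  fix a b c :: weyl
  show "a * b * c = a * (b * c)" by (cases a; cases b; cases c) simp_all
  show "1 * a = a" "a * 1 = a" by (cases a; simp add: one_weyl_def)+
qed

end

definition s1 :: weyl where "s1 = STau 0"
definition s0 :: weyl where "s0 = s1 * Tau (-1)"

definition weyl_length :: "weyl \<Rightarrow> nat" where
  "weyl_length w = (LEAST n. \<exists>ss. set ss \<subseteq> {s0, s1} \<and> prod_list ss = w \<and> length ss = n)"

fun root_act :: "weyl \<Rightarrow> root \<Rightarrow> root" where
  "root_act (Tau r) (APlus n) = APlus (n - 2 * r)"
| "root_act (Tau r) (AMinus n) = AMinus (n + 2 * r)"
| "root_act (STau r) (APlus n) = AMinus (n - 2 * r)"
| "root_act (STau r) (AMinus n) = APlus (n + 2 * r)"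

text \<open>
  The action on coweights in which \<open>s\<^sub>0\<close> and \<open>s\<^sub>1\<close> act as the simple reflections. Since
  \<open>s\<^sub>0 = s\<^sub>1\<tau>\<^bsup>-\<alpha>\<^sup>\<or>\<^esup>\<close>, we have \<open>\<tau>\<^bsup>\<alpha>\<^sup>\<or>\<^esup> = s\<^sub>0s\<^sub>1\<close>. See \<open>cw_act_s0\<close>, \<open>cw_act_s1\<close> and
  \<open>cw_act_mult\<close>.
\<close>

definition tau_act :: "int \<Rightarrow> coweight \<Rightarrow> coweight" where
  "tau_act r =
     (if r \<ge> 0 then (reflection alpha0 \<circ> reflection alpha1) ^^ nat r
      else (reflection alpha1 \<circ> reflection alpha0) ^^ nat (- r))"

fun cw_act :: "weyl \<Rightarrow> coweight \<Rightarrow> coweight" where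
  "cw_act (Tau r) = tau_act r"
| "cw_act (STau r) = reflection alpha1 \<circ> tau_act r"

text \<open>The reflection \<open>s\<^sub>\<beta>\<close> as an element of the Weyl group; see \<open>weyl_refl_simps\<close>.\<close>

definition weyl_refl :: "root \<Rightarrow> weyl" where
  "weyl_refl \<beta> = (THE w. cw_act w = reflection \<beta>)"

subsection \<open>Consistency of these conventions\<close>

lemma weyl_inverse: "inverse w * w = 1" "w * inverse w = 1" for w :: weyl
  by (cases w; simp add: one_weyl_def)+

lemma s0_eq: "s0 = STau (-1)"
  by (simp add: s0_def s1_def)

lemma s0_s0: "s0 * s0 = 1" and s1_s1: "s1 * s1 = 1" and s0_s1: "s0 * s1 = Tau 1"
  by (simp_all add: s0_eq s1_def one_weyl_def)

lemma reflection_alpha1: "reflection alpha1 (k, m, l) = (- k, m, l)"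
  by (simp add: reflection_def alpha1_def)

lemma reflection_alpha0: "reflection alpha0 (k, m, l) = (l - k, m + 2 * k - l, l)"
  by (simp add: reflection_def alpha0_def)

lemma cw_act_funpow_nonneg:
  "((reflection alpha0 \<circ> reflection alpha1) ^^ n) (k, m, l)
     = (k + int n * l, m - 2 * int n * k - int n * int n * l, l)"
  by (induction n) (simp_all add: reflection_alpha0 reflection_alpha1 algebra_simps)

lemma cw_act_funpow_neg:
  "((reflection alpha1 \<circ> reflection alpha0) ^^ n) (k, m, l)
     = (k - int n * l, m + 2 * int n * k - int n * int n * l, l)"
  by (induction n) (simp_all add: reflection_alpha0 reflection_alpha1 algebra_simps)

lemma cw_act_Tau: "cw_act (Tau r) (k, m, l) = (k + r * l, m - 2 * r * k - r * r * l, l)"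
  using cw_act_funpow_nonneg[of "nat r" k m l] cw_act_funpow_neg[of "nat (- r)" k m l]
  by (cases "r \<ge> 0") (simp_all add: tau_act_def)

lemma cw_act_STau: "cw_act (STau r) (k, m, l) = (- k - r * l, m - 2 * r * k - r * r * l, l)"
  using cw_act_Tau[of r k m l] by (simp add: reflection_alpha1)

lemma cw_act_mult: "cw_act (v * w) \<mu> = cw_act v (cw_act w \<mu>)"
  by (cases \<mu>; cases v; cases w)
     (simp_all del: cw_act.simps add: cw_act_Tau cw_act_STau algebra_simps)

lemma cw_act_s1: "cw_act s1 = reflection alpha1"
  by (rule ext) (auto simp del: cw_act.simps simp add: s1_def cw_act_STau reflection_alpha1)

lemma cw_act_s0: "cw_act s0 = reflection alpha0"
  by (rule ext) (auto simp del: cw_act.simps simp add: s0_eq cw_act_STau reflection_alpha0)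

lemma cw_act_inj:
  assumes "cw_act v = cw_act w"
  shows "v = w"
proof -
  have "cw_act v (0, 0, 1) = cw_act w (0, 0, 1)" "cw_act v (1, 0, 0) = cw_act w (1, 0, 0)"
    using assms by simp_all
  then show ?thesis
    by (cases v; cases w) (simp_all del: cw_act.simps add: cw_act_Tau cw_act_STau)
qed

lemma cw_act_refl:
  "cw_act (STau n) = reflection (APlus n)" "cw_act (STau (- n)) = reflection (AMinus n)"
  by (rule ext; auto simp del: cw_act.simps simp add: cw_act_STau reflection_def algebra_simps)+

lemma cw_act_weyl_refl: "cw_act (weyl_refl \<beta>) = reflection \<beta>"
proof -
  have "\<exists>w. cw_act w = reflection \<beta>"
    by (cases \<beta>) (auto intro: cw_act_refl)
  then have "\<exists>!w. cw_act w = reflection \<beta>"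
    using cw_act_inj by metis
  then show ?thesis
    unfolding weyl_refl_def by (rule theI')
qed

lemma weyl_refl_simps: "weyl_refl (APlus n) = STau n" "weyl_refl (AMinus n) = STau (- n)"
  by (rule cw_act_inj, simp only: cw_act_weyl_refl flip: cw_act_refl)+

lemma root_act_mult: "root_act (v * w) \<beta> = root_act v (root_act w \<beta>)"
  by (cases v; cases w; cases \<beta>) simp_all

lemma pairing_invariant: "pairing (root_act w \<beta>) (cw_act w \<mu>) = pairing \<beta> \<mu>"
  by (cases \<mu>; cases w; cases \<beta>)
     (simp_all del: cw_act.simps add: cw_act_Tau cw_act_STau algebra_simps)

lemma weyl_induct:
  assumes one: "P 1" and s0: "\<And>w. P w \<Longrightarrow> P (w * s0)" and s1: "\<And>w. P w \<Longrightarrow> P (w * s1)"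
  shows "P w"
proof -
  have up: "P (Tau (int n))" and dn: "P (Tau (- int n))" for n
  proof (induction n)
    case 0
    { case 1 show ?case using one by (simp add: one_weyl_def) }
    { case 2 show ?case using one by (simp add: one_weyl_def) }
  next
    case (Suc n)
    { case 1
      have "Tau (int (Suc n)) = Tau (int n) * s0 * s1" by (simp add: s0_eq s1_def)
      then show ?case using Suc.IH(1) s0 s1 by metis }
    { case 2
      have "Tau (- int (Suc n)) = Tau (- int n) * s1 * s0" by (simp add: s0_eq s1_def)
      then show ?case using Suc.IH(2) s0 s1 by metis }
  qed
  have T: "P (Tau r)" for r
    using up[of "nat r"] dn[of "nat (- r)"] by (cases "r \<ge> 0") simp_all
  have "STau r = Tau (- r) * s1" for r by (simp add: s1_def)
  then have "P (STau r)" for r using T s1 by metis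
  with T show ?thesis by (cases w) simp_all
qed

lemma weyl_generated: "\<exists>ss. set ss \<subseteq> {s0, s1} \<and> prod_list ss = w"
proof (induction w rule: weyl_induct)
  case 1
  show ?case by (intro exI[of _ "[]"]) simp
next
  case (2 w)
  then obtain ss where "set ss \<subseteq> {s0, s1}" "prod_list ss = w" by blast
  then show ?case by (intro exI[of _ "ss @ [s0]"]) simp
next
  case (3 w)
  then obtain ss where "set ss \<subseteq> {s0, s1}" "prod_list ss = w" by blast
  then show ?case by (intro exI[of _ "ss @ [s1]"]) simp
qed

lemma weyl_presentation:
  fixes a b :: "'g::monoid_mult"
  assumes a: "a * a = 1" and b: "b * b = 1"
  shows "\<exists>!f. f s0 = a \<and> f s1 = b \<and> f 1 = 1 \<and> (\<forall>v w. f (v * w) = f v * f w)"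
proof -
  define pw where "pw r = (if r \<ge> 0 then (a * b) ^ nat r else (b * a) ^ nat (- r))" for r :: int
  have cancel: "a * (a * x) = x" "b * (b * x) = x" for x
    using a b by (simp_all flip: mult.assoc)
  have nat_suc: "nat (r + 1) = Suc (nat r)" if "r \<ge> 0" for r :: int
    using that by simp
  have pw0: "pw 0 = 1" by (simp add: pw_def)
  have pwS: "pw (r + 1) = a * b * pw r" for r
  proof (cases "r \<ge> 0")
    case True
    then show ?thesis by (simp add: pw_def nat_suc)
  next
    case False
    then have "nat (- r) = Suc (nat (- (r + 1)))" by simp
    then have "pw r = b * a * pw (r + 1)"
      using False by (cases "r = -1") (simp_all add: pw_def mult.assoc)
    then show ?thesis by (simp add: mult.assoc cancel)
  qed
  have pwP: "pw (r - 1) = b * a * pw r" for r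
    using pwS[of "r - 1"] by (simp add: mult.assoc cancel)
  have add: "pw (r + q) = pw r * pw q" for r q
  proof (induction r rule: int_induct[where k = 0])
    case base
    show ?case by (simp add: pw0)
  next
    case (step1 i)
    then show ?case using pwS[of "i + q"] pwS[of i] by (simp add: ac_simps)
  next
    case (step2 i)
    have "pw (i - 1 + q) = b * a * pw (i + q)" using pwP[of "i + q"] by (simp add: algebra_simps)
    then show ?case using step2 pwP[of i] by (simp add: mult.assoc)
  qed
  have sw: "pw r * b = b * pw (- r)" for r
  proof (induction r rule: int_induct[where k = 0])
    case base
    show ?case by (simp add: pw0)
  next
    case (step1 i)
    have "pw (- (i + 1)) = b * a * pw (- i)" using pwP[of "- i"] by simp
    then show ?case using step1 pwS[of i] by (simp add: mult.assoc cancel)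
  next
    case (step2 i)
    have "pw (- (i - 1)) = a * b * pw (- i)" using pwS[of "- i"] by (simp add: algebra_simps)
    then show ?case using step2 pwP[of i] by (simp add: mult.assoc cancel)
  qed
  define f where "f w = (case w of Tau r \<Rightarrow> pw r | STau r \<Rightarrow> b * pw r)" for w
  have sw': "pw r * (b * x) = b * (pw (- r) * x)" for r x
    using sw[of r] by (simp flip: mult.assoc)
  have hom: "f (v * w) = f v * f w" for v w
  proof (cases v; cases w)
    fix r q assume "v = Tau r" "w = STau q"
    then show ?thesis using add[of "- r" q] by (simp add: f_def sw')
  next
    fix r q assume "v = STau r" "w = STau q"
    then show ?thesis using add[of "- r" q] by (simp add: f_def sw' mult.assoc cancel)
  qed (simp_all add: f_def add mult.assoc)
  have "f s0 = a" "f s1 = b" "f 1 = 1"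
    using pwP[of 0] by (simp_all add: f_def s0_eq s1_def one_weyl_def pw0 cancel mult.assoc)
  with hom have "f s0 = a \<and> f s1 = b \<and> f 1 = 1 \<and> (\<forall>v w. f (v * w) = f v * f w)" by simp
  then show ?thesis
  proof (rule ex1I[of _ f])
    fix g assume g: "g s0 = a \<and> g s1 = b \<and> g 1 = 1 \<and> (\<forall>v w. g (v * w) = g v * g w)"
    have "g w = f w" for w
    proof (induction w rule: weyl_induct)
      case 1 show ?case using g \<open>f 1 = 1\<close> by simp
    next
      case (2 w) then show ?case using g hom \<open>f s0 = a\<close> by simp
    next
      case (3 w) then show ?case using g hom \<open>f s1 = b\<close> by simp
    qed
    then show "g = f" by (rule ext)
  qed
qed

section \<open>The double affine Weyl semigroup\<close>

definition tits_cone :: "coweight set" where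
  "tits_cone = {(k, m, l) |k m l. l > 0} \<union> {(0, m, 0) |m. True}"

text \<open>The pair \<open>(w, \<mu>)\<close> is \<open>w\<epsilon>\<^sup>\<mu>\<close>.\<close>

type_synonym daw = "weyl \<times> coweight"

definition W_T :: "daw set" where
  "W_T = UNIV \<times> tits_cone"

fun daw_mult :: "daw \<Rightarrow> daw \<Rightarrow> daw" where
  "daw_mult (w, \<mu>) (w', \<mu>') = (w * w', cw_act (inverse w') \<mu> + \<mu>')"

fun lev :: "daw \<Rightarrow> int" where
  "lev (w, (k, m, l)) = l"

section \<open>The quantum Bruhat graph\<close>

text \<open>An edge is a triple of source, weight and target.\<close>

type_synonym edge = "weyl \<times> coweight \<times> weyl"

definition bruhat_edges :: "edge set" where
  "bruhat_edges = {(w, 0, w * weyl_refl \<beta>) |w \<beta>. \<beta> \<in> pos_roots \<and>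
     weyl_length (w * weyl_refl \<beta>) = weyl_length w + 1}"

definition quantum_edges :: "edge set" where
  "quantum_edges = {(w, coroot \<beta>, w * weyl_refl \<beta>) |w \<beta>. \<beta> \<in> pos_roots \<and>
     int (weyl_length (w * weyl_refl \<beta>)) = int (weyl_length w) + 1 - two_rho (coroot \<beta>)}"

definition qbg_edges :: "edge set" where
  "qbg_edges = bruhat_edges \<union> quantum_edges"

fun qbg_path :: "weyl \<Rightarrow> edge list \<Rightarrow> weyl \<Rightarrow> bool" where
  "qbg_path u [] v \<longleftrightarrow> u = v"
| "qbg_path u ((a, c, b) # p) v \<longleftrightarrow> (a, c, b) \<in> qbg_edges \<and> a = u \<and> qbg_path b p v"

definition path_wt :: "edge list \<Rightarrow> coweight" where
  "path_wt p = (\<Sum>(a, c, b)\<leftarrow>p. c)"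

definition qbg_dist :: "weyl \<Rightarrow> weyl \<Rightarrow> nat" where
  "qbg_dist u v = (LEAST n. \<exists>p. qbg_path u p v \<and> length p = n)"

definition shortest_qbg_path :: "weyl \<Rightarrow> edge list \<Rightarrow> weyl \<Rightarrow> bool" where
  "shortest_qbg_path u p v \<longleftrightarrow> qbg_path u p v \<and> length p = qbg_dist u v"

section \<open>Length positivity and the generalised Demazure product\<close>

definition pos_ind :: "root \<Rightarrow> int" where
  "pos_ind \<beta> = (if \<beta> \<in> pos_roots then 1 else 0)"

fun length_fun :: "daw \<Rightarrow> root \<Rightarrow> int" where
  "length_fun (w, \<mu>) \<beta> = pairing \<beta> \<mu> + pos_ind \<beta> - pos_ind (root_act w \<beta>)"

definition LP :: "daw \<Rightarrow> weyl set" where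
  "LP x = {v. \<forall>\<beta>\<in>pos_roots. length_fun x (root_act v \<beta>) \<ge> 0}"

definition min_pairs :: "daw \<Rightarrow> daw \<Rightarrow> (weyl \<times> weyl) set" where
  "min_pairs x y = {(u, v). u \<in> LP x \<and> v \<in> LP y \<and>
     (\<forall>u'\<in>LP x. \<forall>v'\<in>LP y. qbg_dist u (fst y * v) \<le> qbg_dist u' (fst y * v'))}"

fun demazure_at :: "daw \<Rightarrow> daw \<Rightarrow> weyl \<Rightarrow> weyl \<Rightarrow> edge list \<Rightarrow> daw" where
  "demazure_at (wx, \<mu>x) (wy, \<mu>y) u v p =
     (wx * u * inverse v, cw_act (v * inverse u) \<mu>x + \<mu>y - cw_act v (path_wt p))"

definition demazure_values :: "daw \<Rightarrow> daw \<Rightarrow> daw set" where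
  "demazure_values x y = {demazure_at x y u v p |u v p.
     (u, v) \<in> min_pairs x y \<and> shortest_qbg_path u p (fst y * v)}"

text \<open>Only meaningful when \<^term>\<open>demazure_values x y\<close> is a singleton.\<close>

definition demazure :: "daw \<Rightarrow> daw \<Rightarrow> daw" where
  "demazure x y = the_elem (demazure_values x y)"

end

theory Submission
  imports Defs
begin

text \<open>
  Numbering the alcoves of the affine line identifies \<open>W\<close> with the integers, the length with the absolute value,
  and gives closed forms for distances and weights in the quantum Bruhat graph. As \<open>\<beta>\<close> runs through
  \<open>\<alpha> + n\<delta>\<close>, the length \<open>\<ell>(x, \<beta>)\<close> is increasing with slope about the level, so \<open>LP x\<close> consists of
  consecutive alcoves: at most three, and at most two if the level exceeds one.

  For \<open>(u, v)\<close> minimal and \<open>b = w\<^sub>y v\<close> the product satisfies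
  \<open>\<ell>(x * y, v\<alpha>) = \<ell>(x, u\<alpha>) + \<ell>(y, v\<alpha>) + excess \<alpha> u b\<close>. The excess is negative only if \<open>us\<^sub>\<alpha>\<close> is
  closer to \<open>b\<close> and \<open>bs\<^sub>\<alpha>\<close> closer to \<open>u\<close>, which minimality then rules out for \<open>LP x\<close> and \<open>LP y\<close>. Two minimal
  pairs differ at most by a common right factor \<open>s\<^sub>\<alpha>\<close>, in which case the excess vanishes and the products agree.
  For the same reason \<open>LP (x * y)\<close> is the set of second components of minimal pairs, so both bracketings of
  \<open>x * y * z\<close> are governed by the minimal pairs of \<open>(x, y)\<close> and \<open>(y, z)\<close>.
\<close>

section \<open>Linearity of the action and the pairing, and calculation with inverses\<close>

declare cw_act.simps [simp del]
declare cw_act_Tau [simp] cw_act_STau [simp] weyl_refl_simps [simp]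

lemma cw_act_one [simp]: "cw_act 1 \<mu> = \<mu>"
  by (cases \<mu>) (simp add: one_weyl_def)

lemma cw_act_add: "cw_act w (\<mu> + \<nu>) = cw_act w \<mu> + cw_act w \<nu>"
  by (cases w; cases \<mu>; cases \<nu>) (simp_all add: algebra_simps)

lemma cw_act_diff: "cw_act w (\<mu> - \<nu>) = cw_act w \<mu> - cw_act w \<nu>"
  by (cases w; cases \<mu>; cases \<nu>) (simp_all add: algebra_simps)

lemma cw_act_level: "snd (snd (cw_act w \<mu>)) = snd (snd \<mu>)"
  by (cases w; cases \<mu>) simp_all

lemma lev_eq: "lev x = snd (snd (snd x))"
  by (cases x rule: lev.cases) simp

lemma inverse_mult_cancel [simp]:
  "inverse w * (w * v) = v" "w * (inverse w * v) = v" for v w :: weyl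
  by (simp_all add: weyl_inverse flip: mult.assoc)

lemma inverse_weyl_simps [simp]: "inverse w * w = 1" "w * inverse w = 1" for w :: weyl
  by (simp_all add: weyl_inverse)

lemma inverse_weyl_mult: "inverse (v * w) = inverse w * inverse v" for v w :: weyl
  by (cases v; cases w) simp_all

lemma pairing_add: "pairing \<beta> (\<mu> + \<nu>) = pairing \<beta> \<mu> + pairing \<beta> \<nu>"
  by (cases \<beta>; cases \<mu>; cases \<nu>) (simp_all add: algebra_simps)

lemma pairing_diff: "pairing \<beta> (\<mu> - \<nu>) = pairing \<beta> \<mu> - pairing \<beta> \<nu>"
  by (cases \<beta>; cases \<mu>; cases \<nu>) (simp_all add: algebra_simps)

lemma pos_ind_simps [simp]:
  "pos_ind (APlus n) = (if n \<ge> 0 then 1 else 0)"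
  "pos_ind (AMinus n) = (if n \<ge> 1 then 1 else 0)"
  by (auto simp: pos_ind_def pos_roots_def)

definition simple_roots :: "root set" where
  "simple_roots = {alpha0, alpha1}"

lemma simple_rootsE:
  assumes "\<alpha> \<in> simple_roots"
  obtains "\<alpha> = AMinus 1" | "\<alpha> = APlus 0"
  using assms by (auto simp: simple_roots_def alpha0_def alpha1_def)

lemma weyl_refl_involution:
  assumes "\<alpha> \<in> simple_roots"
  shows "weyl_refl \<alpha> * weyl_refl \<alpha> = 1" "inverse (weyl_refl \<alpha>) = weyl_refl \<alpha>"
    "w * weyl_refl \<alpha> * weyl_refl \<alpha> = w"
  using assms by (auto elim!: simple_rootsE simp: one_weyl_def[symmetric] mult.assoc)

section \<open>Alcoves\<close>

text \<open>
  The positive system \<open>w\<Phi>\<^sup>+\<close> contains \<open>\<alpha> + n\<delta>\<close> exactly for \<open>n \<ge> alcove w\<close>: this numbers the alcoves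
  of the affine line from left to right, with \<open>1\<close> at position \<open>0\<close>.
\<close>

fun alcove :: "weyl \<Rightarrow> int" where
  "alcove (Tau r) = - 2 * r"
| "alcove (STau r) = 2 * r + 1"

lemma alcove_inj: "alcove v = alcove w \<Longrightarrow> v = w"
  by (cases v; cases w) (simp_all, presburger+)

lemma alcove_eq_iff [simp]: "alcove v = alcove w \<longleftrightarrow> v = w"
  using alcove_inj by blast

lemma alcove_surj: "\<exists>w. alcove w = n"
proof (cases "even n")
  case True
  then show ?thesis by (intro exI[of _ "Tau (- (n div 2))"]) simp
next
  case False
  then show ?thesis by (intro exI[of _ "STau (n div 2)"]) simp
qed

lemma alcove_one [simp]: "alcove 1 = 0"
  by (simp add: one_weyl_def)

text \<open>\<open>W\<close> acts on the affine line from the left by isometries: even alcoves act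
  as translations, odd ones as reflections. Distances between alcoves are therefore
  preserved.\<close>

lemma alcove_mult: "alcove (v * w) = (if even (alcove v) then alcove v + alcove w else alcove v - alcove w)"
  by (cases v; cases w) simp_all

lemma alcove_mult_refl:
  "alcove (w * weyl_refl (APlus 0)) = (if even (alcove w) then alcove w + 1 else alcove w - 1)"
  "alcove (w * weyl_refl (AMinus 1)) = (if even (alcove w) then alcove w - 1 else alcove w + 1)"
  by (cases w; simp)+

lemma alcove_adjacent:
  assumes "\<bar>alcove v - alcove w\<bar> = 1"
  obtains \<alpha> where "\<alpha> \<in> simple_roots" "w = v * weyl_refl \<alpha>"
proof -
  have "alcove w = alcove (v * weyl_refl (APlus 0)) \<or> alcove w = alcove (v * weyl_refl (AMinus 1))"
    unfolding alcove_mult_refl using assms by (auto simp: abs_if split: if_splits)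
  then show ?thesis
    using that by (auto simp: simple_roots_def alpha0_def alpha1_def simp del: weyl_refl_simps)
qed

lemma pos_ind_root_act:
  "pos_ind (root_act w (APlus 0)) = (if even (alcove w) = (alcove w \<ge> 0) then 1 else 0)"
  "pos_ind (root_act w (AMinus 1)) = (if even (alcove w) = (alcove w \<le> 0) then 1 else 0)"
  by (cases w; simp; presburger)+

text \<open>A right factor \<open>s0\<close> or \<open>s1\<close> moves to an adjacent alcove, so a
  word of length n stays within distance n of 0. Away from 0, one of the two generators always moves
  closer.\<close>

lemma weyl_length_eq: "weyl_length w = nat \<bar>alcove w\<bar>"
  unfolding weyl_length_def
proof (rule Least_equality)
  have "\<exists>ss. set ss \<subseteq> {s0, s1} \<and> prod_list ss = w \<and> length ss = n" if "nat \<bar>alcove w\<bar> = n" for n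
    using that
  proof (induction n arbitrary: w)
    case 0
    then have "alcove w = alcove 1" by simp
    then show ?case by (intro exI[of _ "[]"]) (simp del: alcove_one)
  next
    case (Suc n)
    have s: "s0 = weyl_refl (AMinus 1)" "s1 = weyl_refl (APlus 0)"
      by (simp_all add: s0_eq s1_def)
    have "\<exists>s\<in>{s0, s1}. nat \<bar>alcove (w * s)\<bar> = n"
      using Suc.prems unfolding s by (simp add: alcove_mult_refl del: weyl_refl_simps) linarith
    then obtain s where "s \<in> {s0, s1}" and n: "nat \<bar>alcove (w * s)\<bar> = n" by blast
    moreover from this have "w * s * s = w"
      using s0_s0 s1_s1 by (auto simp: mult.assoc)
    moreover obtain ss where "set ss \<subseteq> {s0, s1}" "prod_list ss = w * s" "length ss = n"
      using Suc.IH[OF n] by blast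
    ultimately show ?case by (intro exI[of _ "ss @ [s]"]) auto
  qed
  then show "\<exists>ss. set ss \<subseteq> {s0, s1} \<and> prod_list ss = w \<and> length ss = nat \<bar>alcove w\<bar>"
    by blast
next
  fix n assume "\<exists>ss. set ss \<subseteq> {s0, s1} \<and> prod_list ss = w \<and> length ss = n"
  then obtain ss where "set ss \<subseteq> {s0, s1}" "prod_list ss = w" "length ss = n" by blast
  moreover have "set ss \<subseteq> {s0, s1} \<Longrightarrow> \<bar>alcove (prod_list ss)\<bar> \<le> int (length ss)" for ss
  proof (induction ss rule: rev_induct)
    case Nil
    show ?case by simp
  next
    case (snoc s ss)
    then have "\<bar>alcove (prod_list ss * s) - alcove (prod_list ss)\<bar> = 1"
      by (auto simp: s0_eq s1_def alcove_mult)
    with snoc show ?case by simp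
  qed
  ultimately show "nat \<bar>alcove w\<bar> \<le> n" by fastforce
qed

section \<open>Distances and weights in the quantum Bruhat graph\<close>

text \<open>The distance in the graph from alcove p to alcove q. Quantum edges descend on one side
  only, while a Bruhat edge may end on either side. The summand 2 pays for a change of side: one
  more edge up and one more down.\<close>

definition qd :: "int \<Rightarrow> int \<Rightarrow> int" where
  "qd p q = (if \<bar>p\<bar> < \<bar>q\<bar> then \<bar>q\<bar> - \<bar>p\<bar>
     else if p > 0 \<and> q < 0 \<or> p < 0 \<and> q > 0 then \<bar>p\<bar> - \<bar>q\<bar> + 2 else \<bar>p\<bar> - \<bar>q\<bar>)"

text \<open>The weight of the path of quantum edges from the alcove \<open>p\<close> down to the fundamental alcove.\<close>

definition down_wt :: "int \<Rightarrow> coweight" where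
  "down_wt p = (if p \<ge> 0 then (p mod 2, p div 2, 0) else (- (p mod 2), (1 - p) div 2, 0))"

text \<open>The descents from p and from the alcove one step longer on the other side use the same
  sequence of simple coroots, except that the longer one has an additional last edge. Its weight is
  a constant, which cancels in differences of \<open>down_wt\<close>.\<close>

lemma down_wt_flip:
  "p \<ge> 0 \<Longrightarrow> down_wt p = down_wt (- p - 1) + (1, -1, 0)"
  "p \<le> 0 \<Longrightarrow> down_wt p = down_wt (1 - p) - (1, 0, 0)"
  unfolding down_wt_def by (simp_all, presburger+)

text \<open>
  Signs distinguish the two infinite reduced words. A shortest path to an alcove at most as long but
  of the opposite sign may descend to just below the target and cross there with its last, Bruhat, edge.
\<close>

definition qwt :: "int \<Rightarrow> int \<Rightarrow> coweight" where
  "qwt p q = (if \<bar>p\<bar> < \<bar>q\<bar> then 0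
     else if p > 0 \<and> q < 0 then down_wt p - down_wt (- q - 1)
     else if p < 0 \<and> q > 0 then down_wt p - down_wt (1 - q)
     else down_wt p - down_wt q)"

definition qbg_wt :: "weyl \<Rightarrow> weyl \<Rightarrow> coweight" where
  "qbg_wt u v = qwt (alcove u) (alcove v)"

lemma qwt_level: "snd (snd (qwt p q)) = 0"
  by (simp add: qwt_def down_wt_def zero_prod_def)

lemma qd_nonneg: "qd p q \<ge> 0"
  by (simp add: qd_def)

lemma qd_eq_0_iff: "qd p q = 0 \<longleftrightarrow> p = q"
  by (auto simp: qd_def)

lemma qwt_refl [simp]: "qwt p p = 0"
  by (auto simp: qwt_def)

lemma qd_bruhat_step: "\<bar>p'\<bar> = \<bar>p\<bar> + 1 \<Longrightarrow> qd p q \<le> qd p' q + 1"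
  by (auto simp: qd_def abs_if split: if_splits)

lemma qwt_bruhat_step:
  assumes "\<bar>p'\<bar> = \<bar>p\<bar> + 1" "qd p q = qd p' q + 1"
  shows "qwt p q = qwt p' q"
proof (cases "\<bar>p\<bar> < \<bar>q\<bar>")
  case True
  then have "\<bar>p'\<bar> < \<bar>q\<bar> \<or> p' = q"
    using assms by (auto simp: qd_def split: if_splits)
  with True show ?thesis by (auto simp: qwt_def)
next
  case False
  \<comment> \<open>Towards an alcove that is not longer, a shortest path can start upwards only by
    changing sides at once.\<close>
  then have "p > 0 \<and> q < 0 \<and> p' = - p - 1 \<or> p < 0 \<and> q > 0 \<and> p' = 1 - p"
    using assms by (auto simp: qd_def abs_if split: if_splits)
  then show ?thesis
  proof (elim disjE conjE)
    assume "p > 0" "q < 0" "p' = - p - 1"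
    then show ?thesis
      using False down_wt_flip(1)[of p] down_wt_flip(1)[of "- q - 1"] by (simp add: qwt_def)
  next
    assume "p < 0" "q > 0" "p' = 1 - p"
    then show ?thesis
      using False down_wt_flip(2)[of p] down_wt_flip(2)[of "1 - q"] by (simp add: qwt_def)
  qed
qed

lemma qd_quantum_step: "\<bar>p'\<bar> = \<bar>p\<bar> - 1 \<Longrightarrow> \<bar>p - p'\<bar> = 1 \<Longrightarrow> qd p q \<le> qd p' q + 1"
  by (auto simp: qd_def abs_if split: if_splits)

lemma qwt_quantum_step:
  assumes "\<bar>p'\<bar> = \<bar>p\<bar> - 1" "\<bar>p - p'\<bar> = 1" "qd p q = qd p' q + 1"
  shows "qwt p q = down_wt p - down_wt p' + qwt p' q"
proof -
  have p': "p > 0 \<and> p' = p - 1 \<or> p < 0 \<and> p' = p + 1"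
    using assms(1,2) by linarith
  \<comment> \<open>A shortest path starts downwards only towards a shorter alcove or towards the
    mirror image of p, where the next edge crosses.\<close>
  then have "\<bar>q\<bar> < \<bar>p\<bar> \<or> q = - p"
    using assms(3) by (auto simp: qd_def split: if_splits)
  then show ?thesis
  proof
    assume "\<bar>q\<bar> < \<bar>p\<bar>"
    with p' show ?thesis by (auto simp: qwt_def add.commute)
  next
    assume "q = - p"
    with p' show ?thesis by (auto simp: qwt_def add.commute)
  qed
qed

section \<open>Edges of the graph in terms of alcoves\<close>

lemma down_wt_simple_step:
  assumes "\<alpha> \<in> simple_roots" "\<bar>alcove (w * weyl_refl \<alpha>)\<bar> = \<bar>alcove w\<bar> - 1"
  shows "\<bar>alcove w - alcove (w * weyl_refl \<alpha>)\<bar> = 1"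
    "coroot \<alpha> = down_wt (alcove w) - down_wt (alcove (w * weyl_refl \<alpha>))"
    "pos_ind (root_act w \<alpha>) = 0"
proof -
  have *: "down_wt p - down_wt (p - 1) = (if odd p then (1, 0, 0) else (-1, 1, 0))" if "p > 0" for p
    using that unfolding down_wt_def by (simp, presburger)
  have **: "down_wt p - down_wt (p + 1) = (if even p then (1, 0, 0) else (-1, 1, 0))" if "p < 0" for p
    using that unfolding down_wt_def by (simp, presburger)
  have p: "alcove (w * weyl_refl \<alpha>) = alcove w - 1 \<and> alcove w > 0 \<or>
      alcove (w * weyl_refl \<alpha>) = alcove w + 1 \<and> alcove w < 0"
    using assms(1,2) by (cases rule: simple_rootsE)
      (auto simp del: weyl_refl_simps simp add: alcove_mult_refl abs_if split: if_splits)
  then show "\<bar>alcove w - alcove (w * weyl_refl \<alpha>)\<bar> = 1"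
    by auto
  from assms(1) p show "coroot \<alpha> = down_wt (alcove w) - down_wt (alcove (w * weyl_refl \<alpha>))"
    by (cases rule: simple_rootsE)
      (auto simp del: weyl_refl_simps simp add: alcove_mult_refl * ** split: if_splits)
  from assms(1) p show "pos_ind (root_act w \<alpha>) = 0"
    by (cases rule: simple_rootsE)
      (auto simp del: weyl_refl_simps simp add: alcove_mult_refl pos_ind_root_act split: if_splits)
qed

text \<open>Elements whose lengths have different parity always differ by a reflection in the
  infinite dihedral group, so the length condition alone yields an edge.\<close>

lemma bruhat_edge:
  assumes "\<bar>alcove w'\<bar> = \<bar>alcove w\<bar> + 1"
  shows "(w, 0, w') \<in> qbg_edges"
proof -
  have "\<exists>n. w' = w * STau n"
  proof (cases w; cases w')
    fix r q assume "w = Tau r" "w' = Tau q"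
    with assms show ?thesis by (simp add: abs_if split: if_splits) presburger+
  next
    fix r q assume "w = Tau r" "w' = STau q"
    then show ?thesis by (intro exI[of _ "q + r"]) simp
  next
    fix r q assume "w = STau r" "w' = Tau q"
    then show ?thesis by (intro exI[of _ "q + r"]) simp
  next
    fix r q assume "w = STau r" "w' = STau q"
    with assms show ?thesis by (simp add: abs_if split: if_splits) presburger+
  qed
  then obtain n where n: "w' = w * STau n" by blast
  \<comment> \<open>The positive one of the two opposite roots with reflection
    \<open>STau n\<close>.\<close>
  define \<beta> where "\<beta> = (if n \<ge> 0 then APlus n else AMinus (- n))"
  have "\<beta> \<in> pos_roots" "w' = w * weyl_refl \<beta>"
    by (auto simp: \<beta>_def pos_roots_def n)
  moreover have "weyl_length w' = weyl_length w + 1"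
    using assms by (simp add: weyl_length_eq)
  ultimately show ?thesis
    unfolding qbg_edges_def bruhat_edges_def by auto
qed

lemma two_rho_simple:
  assumes "\<alpha> \<in> simple_roots"
  shows "two_rho (coroot \<alpha>) = 2" "\<alpha> \<in> pos_roots"
  using assms by (auto elim!: simple_rootsE simp: pos_roots_def)

lemma quantum_edge:
  assumes "\<alpha> \<in> simple_roots" "\<bar>alcove (w * weyl_refl \<alpha>)\<bar> = \<bar>alcove w\<bar> - 1"
  shows "(w, coroot \<alpha>, w * weyl_refl \<alpha>) \<in> qbg_edges"
proof -
  have "int (weyl_length (w * weyl_refl \<alpha>)) = int (weyl_length w) + 1 - two_rho (coroot \<alpha>)"
    using assms two_rho_simple by (simp add: weyl_length_eq)
  then show ?thesis
    unfolding qbg_edges_def quantum_edges_def using two_rho_simple(2)[OF assms(1)] by auto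
qed

text \<open>
  Since \<open>\<langle>2\<rho>, \<beta>\<^sup>\<or>\<rangle> - 1\<close> exceeds the length of \<open>s\<^sub>\<beta>\<close> for every nonsimple \<open>\<beta>\<close>, all quantum edges come
  from simple reflections.
\<close>

lemma qbg_edges_cases:
  assumes "(w, c, w') \<in> qbg_edges"
  obtains (bruhat) "c = 0" "\<bar>alcove w'\<bar> = \<bar>alcove w\<bar> + 1"
  | (quantum) \<alpha> where "\<alpha> \<in> simple_roots" "c = coroot \<alpha>" "w' = w * weyl_refl \<alpha>"
      "\<bar>alcove w'\<bar> = \<bar>alcove w\<bar> - 1"
proof -
  from assms consider "(w, c, w') \<in> bruhat_edges" | "(w, c, w') \<in> quantum_edges"
    by (auto simp: qbg_edges_def)
  then show thesis
  proof cases
    case 1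
    then show thesis
      by (intro bruhat) (auto simp: bruhat_edges_def weyl_length_eq)
  next
    case 2
    then obtain \<beta> where \<beta>: "\<beta> \<in> pos_roots" "c = coroot \<beta>" "w' = w * weyl_refl \<beta>"
      and "int (weyl_length w') = int (weyl_length w) + 1 - two_rho (coroot \<beta>)"
      by (auto simp: quantum_edges_def)
    then have len: "\<bar>alcove w'\<bar> = \<bar>alcove w\<bar> + 1 - two_rho (coroot \<beta>)"
      by (simp add: weyl_length_eq)
    have "\<bar>alcove w\<bar> \<le> \<bar>alcove w'\<bar> + \<bar>alcove (weyl_refl \<beta>)\<bar>"
      unfolding \<beta>(3) alcove_mult by auto
    then have "two_rho (coroot \<beta>) \<le> \<bar>alcove (weyl_refl \<beta>)\<bar> + 1"
      using len by simp
    then have "\<beta> \<in> simple_roots"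
      using \<beta>(1) by (auto simp: pos_roots_def simple_roots_def alpha0_def alpha1_def)
    with \<beta> len show thesis
      using quantum[of \<beta>] two_rho_simple(1)[of \<beta>] by simp
  qed
qed

text \<open>\<open>qd\<close> and \<open>qbg_wt\<close> serve as potentials: an edge lowers the
  distance to the target by at most one, and when it does so, its weight is the drop of
  \<open>qbg_wt\<close>.\<close>

lemma qbg_edge_qd:
  assumes "(w, c, w') \<in> qbg_edges"
  shows "qd (alcove w) (alcove v) \<le> qd (alcove w') (alcove v) + 1"
    and "qd (alcove w) (alcove v) = qd (alcove w') (alcove v) + 1 \<Longrightarrow> qbg_wt w v = c + qbg_wt w' v"
  using assms
  by (cases rule: qbg_edges_cases;
      simp add: qbg_wt_def qd_bruhat_step qwt_bruhat_step down_wt_simple_step qd_quantum_step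
        qwt_quantum_step del: weyl_refl_simps)+

lemma qbg_edge_towards:
  assumes "u \<noteq> v"
  shows "\<exists>c u'. (u, c, u') \<in> qbg_edges \<and> qd (alcove u) (alcove v) = qd (alcove u') (alcove v) + 1"
proof (cases "\<bar>alcove u\<bar> < \<bar>alcove v\<bar>")
  case True
  obtain u' where "alcove u' = (if alcove v > 0 then \<bar>alcove u\<bar> + 1 else - \<bar>alcove u\<bar> - 1)"
    using alcove_surj by blast
  with True have "\<bar>alcove u'\<bar> = \<bar>alcove u\<bar> + 1"
      "qd (alcove u) (alcove v) = qd (alcove u') (alcove v) + 1"
    by (auto simp: qd_def)
  then show ?thesis using bruhat_edge by blast
next
  case False
  have "alcove u \<noteq> alcove v" using assms by simp
  with False have 0: "alcove u \<noteq> 0" by linarith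
  obtain u' where u': "alcove u' = (if alcove u > 0 then alcove u - 1 else alcove u + 1)"
    using alcove_surj by blast
  have "\<bar>alcove u - alcove u'\<bar> = 1" using u' by simp
  then obtain \<alpha> where "\<alpha> \<in> simple_roots" "u' = u * weyl_refl \<alpha>"
    by (rule alcove_adjacent)
  moreover have "\<bar>alcove u'\<bar> = \<bar>alcove u\<bar> - 1" using u' 0 by auto
  moreover have "qd (alcove u) (alcove v) = qd (alcove u') (alcove v) + 1"
    using u' False \<open>alcove u \<noteq> alcove v\<close>
    by (auto simp: qd_def simp del: alcove_eq_iff split: if_splits)
  ultimately show ?thesis using quantum_edge by blast
qed

text \<open>Telescoping of \<open>qbg_edge_qd\<close>: a path that attains the bound attains it at
  every edge, which fixes its weight. Hence shortest paths with the same ends have the same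
  weight.\<close>

lemma qbg_path_bound:
  assumes "qbg_path u p v"
  shows "qd (alcove u) (alcove v) \<le> int (length p) \<and>
    (int (length p) = qd (alcove u) (alcove v) \<longrightarrow> path_wt p = qbg_wt u v)"
  using assms
proof (induction p arbitrary: u)
  case Nil
  then show ?case by (simp add: qd_def path_wt_def qbg_wt_def)
next
  case (Cons e p)
  obtain a c b where e: "e = (a, c, b)" by (cases e)
  with Cons.prems have edge: "(u, c, b) \<in> qbg_edges" and p: "qbg_path b p v"
    by auto
  have "path_wt (e # p) = c + path_wt p"
    by (simp add: path_wt_def e)
  then show ?case
    using Cons.IH[OF p] qbg_edge_qd[OF edge, of v] by auto
qed

lemma qbg_path_exists: "\<exists>p. qbg_path u p v \<and> int (length p) = qd (alcove u) (alcove v)"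
proof (induction "nat (qd (alcove u) (alcove v))" arbitrary: u)
  case 0
  then have "u = v" using qd_nonneg[of "alcove u" "alcove v"] by (simp add: qd_eq_0_iff)
  then show ?case by (intro exI[of _ "[]"]) (simp add: qd_def)
next
  case (Suc n)
  then have "u \<noteq> v" by (auto simp: qd_def)
  then obtain c u' where "(u, c, u') \<in> qbg_edges"
      and "qd (alcove u) (alcove v) = qd (alcove u') (alcove v) + 1"
    using qbg_edge_towards by blast
  moreover from this Suc.hyps(2) have "n = nat (qd (alcove u') (alcove v))"
    by simp
  with Suc.hyps(1) obtain p where "qbg_path u' p v" "int (length p) = qd (alcove u') (alcove v)"
    by blast
  ultimately show ?case by (intro exI[of _ "(u, c, u') # p"]) simp
qed

lemma qbg_dist_eq: "int (qbg_dist u v) = qd (alcove u) (alcove v)"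
proof -
  have "qbg_dist u v = nat (qd (alcove u) (alcove v))"
    unfolding qbg_dist_def
  proof (rule Least_equality)
    show "\<exists>p. qbg_path u p v \<and> length p = nat (qd (alcove u) (alcove v))"
      using qbg_path_exists[of u v] by (metis nat_int)
    show "nat (qd (alcove u) (alcove v)) \<le> n" if "\<exists>p. qbg_path u p v \<and> length p = n" for n
      using that qbg_path_bound by fastforce
  qed
  then show ?thesis using qd_nonneg by simp
qed

lemma shortest_qbg_path_wt: "shortest_qbg_path u p v \<Longrightarrow> path_wt p = qbg_wt u v"
  using qbg_path_bound[of u p v] qbg_dist_eq[of u v] by (auto simp: shortest_qbg_path_def)

lemma shortest_qbg_path_exists: "\<exists>p. shortest_qbg_path u p v"
  using qbg_path_exists[of u v] qbg_dist_eq[of u v] by (auto simp: shortest_qbg_path_def)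

section \<open>Crossing one wall: effect on distances and weights\<close>

lemma qd_even: "even (qd p q) \<longleftrightarrow> even (p - q)"
  by (auto simp: qd_def abs_if)

lemma qd_adjacent:
  "\<bar>p - p'\<bar> = 1 \<Longrightarrow> qd p' q = qd p q + 1 \<or> qd p q = qd p' q + 1"
  "\<bar>q - q'\<bar> = 1 \<Longrightarrow> qd p q' = qd p q + 1 \<or> qd p q = qd p q' + 1"
proof -
  have right: "qd p (q + 1) = qd p q + 1 \<or> qd p q = qd p (q + 1) + 1" for p q
    by (cases "\<bar>p\<bar> < \<bar>q\<bar>"; cases "p > 0"; cases "p < 0"; cases "q \<ge> 0"; auto simp: qd_def)
  have left: "qd (p + 1) q = qd p q + 1 \<or> qd p q = qd (p + 1) q + 1" for p q
    by (cases "\<bar>p\<bar> < \<bar>q\<bar>"; cases "q > 0"; cases "q < 0"; cases "p \<ge> 0"; auto simp: qd_def)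
  show "qd p' q = qd p q + 1 \<or> qd p q = qd p' q + 1" if "\<bar>p - p'\<bar> = 1"
  proof -
    have "p' = p + 1 \<or> p = p' + 1" using that by linarith
    then show ?thesis using left by metis
  qed
  show "qd p q' = qd p q + 1 \<or> qd p q = qd p q' + 1" if "\<bar>q - q'\<bar> = 1"
  proof -
    have "q' = q + 1 \<or> q = q' + 1" using that by linarith
    then show ?thesis using right by metis
  qed
qed

text \<open>The image of \<alpha> under \<open>w\<close> belongs to the wall between
  \<open>w\<close> and its neighbour. It is the least \<open>APlus n\<close> in the positive system
  of \<open>w\<close>, or the negative of the greatest one outside it.\<close>

lemma simple_reflection_alcove:
  assumes "\<alpha> \<in> simple_roots"
  shows "root_act w \<alpha> = APlus (alcove w) \<and> alcove (w * weyl_refl \<alpha>) = alcove w + 1 \<or>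
    root_act w \<alpha> = AMinus (1 - alcove w) \<and> alcove (w * weyl_refl \<alpha>) = alcove w - 1"
  using assms by (cases rule: simple_rootsE; cases w) auto

lemma simple_reflection_adjacent:
  "\<alpha> \<in> simple_roots \<Longrightarrow> \<bar>alcove w - alcove (w * weyl_refl \<alpha>)\<bar> = 1"
  using simple_reflection_alcove[of \<alpha> w] by auto

lemma pos_ind_simple:
  assumes "\<alpha> \<in> simple_roots"
  shows "pos_ind (root_act w \<alpha>) = 1 \<and> \<bar>alcove (w * weyl_refl \<alpha>)\<bar> = \<bar>alcove w\<bar> + 1 \<or>
    pos_ind (root_act w \<alpha>) = 0 \<and> \<bar>alcove (w * weyl_refl \<alpha>)\<bar> = \<bar>alcove w\<bar> - 1"
  using simple_reflection_alcove[OF assms, of w] by (auto split: if_splits)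

lemma cw_scale_0_1 [simp]: "cw_scale 0 \<mu> = 0" "cw_scale 1 \<mu> = \<mu>"
  by (cases \<mu>; simp add: zero_prod_def)+

text \<open>A wall can be crossed along edges in both directions, upwards by a Bruhat and downwards
  by a quantum edge; the scalar selects the weight.\<close>

lemma simple_reflection_edge:
  assumes "\<alpha> \<in> simple_roots"
  shows "(w, cw_scale (1 - pos_ind (root_act w \<alpha>)) (coroot \<alpha>), w * weyl_refl \<alpha>) \<in> qbg_edges"
  using pos_ind_simple[OF assms, of w] bruhat_edge quantum_edge[OF assms] by auto

lemma pos_ind_simple_reflected:
  assumes "\<alpha> \<in> simple_roots"
  shows "pos_ind (root_act (w * weyl_refl \<alpha>) \<alpha>) = 1 - pos_ind (root_act w \<alpha>)"
  using pos_ind_simple[OF assms, of w] pos_ind_simple[OF assms, of "w * weyl_refl \<alpha>"]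
    weyl_refl_involution(3)[OF assms, of w] by auto

lemma qbg_dist_adjacent:
  assumes "\<alpha> \<in> simple_roots"
  shows "qbg_dist (u * weyl_refl \<alpha>) v = qbg_dist u v + 1 \<or> qbg_dist u v = qbg_dist (u * weyl_refl \<alpha>) v + 1"
    and "qbg_dist u (v * weyl_refl \<alpha>) = qbg_dist u v + 1 \<or> qbg_dist u v = qbg_dist u (v * weyl_refl \<alpha>) + 1"
  using qd_adjacent(1)[OF simple_reflection_adjacent[OF assms, of u], of "alcove v"]
    qd_adjacent(2)[OF simple_reflection_adjacent[OF assms, of v], of "alcove u"]
  by (auto simp flip: qbg_dist_eq)

lemma qbg_wt_left:
  assumes "\<alpha> \<in> simple_roots" "qbg_dist (u * weyl_refl \<alpha>) v = qbg_dist u v + 1"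
  shows "qbg_wt (u * weyl_refl \<alpha>) v = qbg_wt u v + cw_scale (pos_ind (root_act u \<alpha>)) (coroot \<alpha>)"
proof -
  have "(u * weyl_refl \<alpha>, cw_scale (pos_ind (root_act u \<alpha>)) (coroot \<alpha>), u) \<in> qbg_edges"
    using simple_reflection_edge[OF assms(1), of "u * weyl_refl \<alpha>"] assms(1)
    by (simp add: pos_ind_simple_reflected weyl_refl_involution del: weyl_refl_simps)
  from qbg_edge_qd(2)[OF this, of v] assms(2) show ?thesis
    by (simp flip: qbg_dist_eq)
qed

lemma qbg_path_append: "qbg_path u p v \<Longrightarrow> qbg_path v q w \<Longrightarrow> qbg_path u (p @ q) w"
  by (induction u p v rule: qbg_path.induct) auto

text \<open>The potential argument concerns the source of a path, so here the wall edge is appended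
  to an explicit shortest path.\<close>

lemma qbg_wt_right:
  assumes "\<alpha> \<in> simple_roots" "qbg_dist u (v * weyl_refl \<alpha>) = qbg_dist u v + 1"
  shows "qbg_wt u (v * weyl_refl \<alpha>) = qbg_wt u v + cw_scale (1 - pos_ind (root_act v \<alpha>)) (coroot \<alpha>)"
proof -
  obtain p where p: "shortest_qbg_path u p v"
    using shortest_qbg_path_exists by blast
  define e where "e = (v, cw_scale (1 - pos_ind (root_act v \<alpha>)) (coroot \<alpha>), v * weyl_refl \<alpha>)"
  have "shortest_qbg_path u (p @ [e]) (v * weyl_refl \<alpha>)"
    using p assms simple_reflection_edge[OF assms(1), of v]
    by (auto simp: shortest_qbg_path_def e_def intro: qbg_path_append)
  from shortest_qbg_path_wt[OF this] shortest_qbg_path_wt[OF p] show ?thesis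
    by (simp add: path_wt_def e_def)
qed

text \<open>
  The amount by which \<open>length_fun\<close> at \<open>\<alpha>\<close> fails to be additive under the Demazure product; see
  \<open>length_fun_demazure_val\<close>.
\<close>

definition excess :: "root \<Rightarrow> weyl \<Rightarrow> weyl \<Rightarrow> int" where
  "excess \<alpha> u v = pos_ind (root_act v \<alpha>) - pos_ind (root_act u \<alpha>) - pairing \<alpha> (qbg_wt u v)"

text \<open>The \<open>\<alpha>\<^sup>\<or>\<close>-coefficients of \<^const>\<open>down_wt\<close> and \<^const>\<open>qwt\<close>.\<close>

definition kwt :: "int \<Rightarrow> int" where
  "kwt p = (if even p then 0 else if p > 0 then 1 else -1)"

definition qkwt :: "int \<Rightarrow> int \<Rightarrow> int" where
  "qkwt p q = (if \<bar>p\<bar> < \<bar>q\<bar> then 0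
     else if p > 0 \<and> q < 0 then kwt p - kwt (- q - 1)
     else if p < 0 \<and> q > 0 then kwt p - kwt (1 - q)
     else kwt p - kwt q)"

section \<open>The excess in alcove coordinates\<close>

lemma fst_qwt: "fst (qwt p q) = qkwt p q"
proof -
  have "fst (down_wt p) = kwt p" for p
    by (auto simp: down_wt_def kwt_def mod_2_eq_odd)
  then show ?thesis
    by (simp add: qwt_def qkwt_def)
qed

lemma pairing_qbg_wt:
  "pairing (APlus 0) (qbg_wt u v) = 2 * qkwt (alcove u) (alcove v)"
  "pairing (AMinus 1) (qbg_wt u v) = - 2 * qkwt (alcove u) (alcove v)"
  using fst_qwt[of "alcove u" "alcove v"] qwt_level[of "alcove u" "alcove v"] unfolding qbg_wt_def
  by (cases "qwt (alcove u) (alcove v)"; simp)+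

lemma parityE:
  fixes p :: int
  obtains h where "p = 2 * h" | h where "p = 2 * h + 1"
  by (metis evenE oddE)

definition qexcess :: "int \<Rightarrow> int \<Rightarrow> int" where
  "qexcess p q = (if even q = (q \<ge> 0) then 1 else 0) - (if even p = (p \<ge> 0) then 1 else 0) - 2 * qkwt p q"

text \<open>
  Right multiplication by \<open>s\<^sub>1\<close> in terms of alcoves. The diagram automorphism is \<open>p \<mapsto> - p\<close>, which turns
  this into right multiplication by \<open>s\<^sub>0\<close> and lets all statements about \<open>\<alpha>\<^sub>0\<close> follow from those about \<open>\<alpha>\<^sub>1\<close>.
\<close>

definition flip1 :: "int \<Rightarrow> int" where
  "flip1 p = (if even p then p + 1 else p - 1)"

lemma flip1_parity: "flip1 (2 * h) = 2 * h + 1" "flip1 (2 * h + 1) = 2 * h"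
  by (auto simp: flip1_def)

lemma kwt_parity:
  "kwt (2 * h) = 0" "kwt (2 * h + 1) = (if h \<ge> 0 then 1 else -1)"
  "kwt (- (2 * h) - 1) = (if h < 0 then 1 else -1)" "kwt (- (2 * h + 1) - 1) = 0"
  "kwt (1 - 2 * h) = (if h \<le> 0 then 1 else -1)" "kwt (1 - (2 * h + 1)) = 0"
  by (auto simp: kwt_def)

text \<open>Once parities and signs are fixed, \<open>kwt\<close> is constant and \<open>qd\<close>
  piecewise linear, which leaves a problem of Presburger arithmetic.\<close>

lemma qexcess_neg:
  "qexcess p q < 0 \<Longrightarrow> qexcess p q = -1 \<and> qd (flip1 p) q < qd p q \<and> qd p (flip1 q) < qd p q"
  by (cases p rule: parityE; cases q rule: parityE; cases "p \<ge> 0"; cases "q \<ge> 0"; hypsubst;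
      unfold qexcess_def qkwt_def qd_def kwt_parity flip1_parity; simp add: abs_if; presburger)

lemma qexcess_zero:
  "qd p q < qd (flip1 p) q \<Longrightarrow> qd p q < qd p (flip1 q) \<Longrightarrow>
    qexcess p q = 0 \<longleftrightarrow> qd (flip1 p) (flip1 q) = qd p q"
  by (cases p rule: parityE; cases q rule: parityE; cases "p \<ge> 0"; cases "q \<ge> 0";
      cases "\<bar>p\<bar> < \<bar>q\<bar>"; hypsubst;
      unfold qexcess_def qkwt_def qd_def kwt_parity flip1_parity; simp add: abs_if; smt (z3))

lemma qd_less_succ_left:
  assumes "qd p q < qd (p + 1) q"
  shows "if p \<ge> 0 then \<bar>q\<bar> \<le> p \<or> q = - p - 1 else q \<le> p \<or> q > - p"
  using assms
  by (cases "p \<ge> 0"; cases "q \<ge> 0"; cases "\<bar>q\<bar> \<le> \<bar>p\<bar>"; auto simp: qd_def split: if_splits)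

text \<open>Distinct simple reflections move ends of equal parity in opposite directions and ends of
  different parity in the same direction; the latter case is \<open>qd_diagonal_same\<close>. It
  suffices to let p move to the right.\<close>

lemma qd_diagonal_opposite:
  assumes "even (p - q)" "qd p q < qd (p + 1) q" "qd p q < qd p (q - 1)"
  shows "qd (p + 1) (q - 1) \<noteq> qd p q"
proof -
  have ne: "p \<noteq> - q - 1" "p \<noteq> 1 - q"
    using assms(1) by auto
  show ?thesis
  proof (cases "p \<ge> 0")
    case True
    then have "\<bar>q\<bar> \<le> p" using qd_less_succ_left[OF assms(2)] ne by auto
    then have "q \<ge> 0" using assms(3) True by (cases "q = -p"; auto simp: qd_def split: if_splits)
    then show ?thesis using \<open>\<bar>q\<bar> \<le> p\<close> by (auto simp: qd_def)
  next
    case False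
    then have q: "q \<le> p \<or> q > - p" using qd_less_succ_left[OF assms(2)] by auto
    then have "q \<le> 0" using assms(3) ne False by (cases "q \<le> 0"; auto simp: qd_def)
    with q show ?thesis using False by (auto simp: qd_def)
  qed
qed

lemma qd_diagonal_same:
  assumes "odd (p - q)" "qd p q < qd (p + 1) q" "qd p q < qd p (q + 1)"
  shows "qd (p + 1) (q + 1) \<noteq> qd p q"
proof -
  have ne: "p \<noteq> q" "p \<noteq> - q"
    using assms(1) by auto
  show ?thesis
  proof (cases "p \<ge> 0")
    case True
    then consider "0 \<le> q" "q < p" | "- p < q" "q < 0" | "q = - p - 1"
      using qd_less_succ_left[OF assms(2)] ne by (simp split: if_splits) linarith
    then show ?thesis using assms(3) True
      by cases (auto simp: qd_def split: if_splits)
  next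
    case False
    then consider "q < p" | "q > - p"
      using qd_less_succ_left[OF assms(2)] ne by (simp split: if_splits) linarith
    then show ?thesis using assms(3) False
      by cases (auto simp: qd_def split: if_splits)
  qed
qed

lemma qd_uminus: "qd (- p) (- q) = qd p q"
  by (auto simp: qd_def)

lemma qkwt_uminus: "qkwt (- p) (- q) = - qkwt p q"
  by (auto simp: qkwt_def kwt_def)

lemma alcove_mult_simple:
  "alcove (w * weyl_refl (APlus 0)) = flip1 (alcove w)"
  "alcove (w * weyl_refl (AMinus 1)) = - flip1 (- alcove w)"
  unfolding alcove_mult_refl by (simp_all add: flip1_def)

lemma qd_flip_distinct:
  assumes "qd p q < qd (flip1 p) q" "qd p q < qd p (- flip1 (- q))"
  shows "qd (flip1 p) (- flip1 (- q)) \<noteq> qd p q"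
proof (cases "even p")
  case True
  then show ?thesis
    using assms qd_diagonal_opposite[of p q] qd_diagonal_same[of p q]
    by (cases "even q") (simp_all add: flip1_def add.commute)
next
  case False
  \<comment> \<open>For odd p the reflection moves p to the left; negating both ends turns this into
    a move to the right.\<close>
  have mirror: "qd (- p) (- q) = qd p q" "qd (- p + 1) (- q) = qd (p - 1) q"
      "qd (- p) (- q + 1) = qd p (q - 1)" "qd (- p) (- q - 1) = qd p (q + 1)"
      "qd (- p + 1) (- q + 1) = qd (p - 1) (q - 1)" "qd (- p + 1) (- q - 1) = qd (p - 1) (q + 1)"
    using qd_uminus[of p q] qd_uminus[of "p - 1" q] qd_uminus[of p "q - 1"] qd_uminus[of p "q + 1"]
      qd_uminus[of "p - 1" "q - 1"] qd_uminus[of "p - 1" "q + 1"]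
    by (simp_all add: minus_diff_commute)
  from False show ?thesis
    using assms qd_diagonal_opposite[of "- p" "- q", unfolded mirror]
      qd_diagonal_same[of "- p" "- q", unfolded mirror]
    by (cases "even q") (simp_all add: flip1_def add.commute)
qed

lemma excess_eq:
  "excess (APlus 0) u v = qexcess (alcove u) (alcove v)"
  "excess (AMinus 1) u v = qexcess (- alcove u) (- alcove v)"
  unfolding excess_def qexcess_def pairing_qbg_wt pos_ind_root_act qkwt_uminus by simp_all

lemma excess_neg:
  assumes "\<alpha> \<in> simple_roots" "excess \<alpha> u v < 0"
  shows "excess \<alpha> u v = -1" "qbg_dist (u * weyl_refl \<alpha>) v < qbg_dist u v"
    "qbg_dist u (v * weyl_refl \<alpha>) < qbg_dist u v"
proof -
  have "excess \<alpha> u v = -1 \<and> qbg_dist (u * weyl_refl \<alpha>) v < qbg_dist u v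
      \<and> qbg_dist u (v * weyl_refl \<alpha>) < qbg_dist u v"
    using assms
    by (cases rule: simple_rootsE)
      (use qexcess_neg[of "alcove u" "alcove v"] qexcess_neg[of "- alcove u" "- alcove v"]
        qd_uminus[of "- flip1 (- alcove u)" "alcove v"] qd_uminus[of "alcove u" "- flip1 (- alcove v)"] in
       \<open>simp_all add: excess_eq alcove_mult_simple qbg_dist_eq qd_uminus
         flip: of_nat_less_iff[where 'a = int] del: weyl_refl_simps\<close>)
  then show "excess \<alpha> u v = -1" "qbg_dist (u * weyl_refl \<alpha>) v < qbg_dist u v"
    "qbg_dist u (v * weyl_refl \<alpha>) < qbg_dist u v" by auto
qed

lemma excess_eq_0_iff:
  assumes "\<alpha> \<in> simple_roots" "qbg_dist u v < qbg_dist (u * weyl_refl \<alpha>) v"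
    "qbg_dist u v < qbg_dist u (v * weyl_refl \<alpha>)"
  shows "excess \<alpha> u v = 0 \<longleftrightarrow> qbg_dist (u * weyl_refl \<alpha>) (v * weyl_refl \<alpha>) = qbg_dist u v"
  using assms
  by (cases rule: simple_rootsE)
    (use qexcess_zero[of "alcove u" "alcove v"] qexcess_zero[of "- alcove u" "- alcove v"]
      qd_uminus[of "- flip1 (- alcove u)" "alcove v"] qd_uminus[of "alcove u" "- flip1 (- alcove v)"]
      qd_uminus[of "- flip1 (- alcove u)" "- flip1 (- alcove v)"] in
     \<open>simp_all add: excess_eq alcove_mult_simple qbg_dist_eq qd_uminus
       flip: of_nat_less_iff[where 'a = int] of_nat_eq_iff[where 'a = int] del: weyl_refl_simps\<close>)

lemma qbg_dist_distinct_reflections: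
  assumes "\<alpha> \<in> simple_roots" "\<beta> \<in> simple_roots" "\<alpha> \<noteq> \<beta>"
    and "qbg_dist u v < qbg_dist (u * weyl_refl \<alpha>) v" "qbg_dist u v < qbg_dist u (v * weyl_refl \<beta>)"
  shows "qbg_dist (u * weyl_refl \<alpha>) (v * weyl_refl \<beta>) \<noteq> qbg_dist u v"
proof -
  consider "\<alpha> = APlus 0" "\<beta> = AMinus 1" | "\<alpha> = AMinus 1" "\<beta> = APlus 0"
    using assms(1-3) by (auto elim!: simple_rootsE)
  then show ?thesis using assms(4,5)
    by cases
      (use qd_flip_distinct[of "alcove u" "alcove v"] qd_flip_distinct[of "- alcove u" "- alcove v"]
        qd_uminus[of "- flip1 (- alcove u)" "alcove v"] qd_uminus[of "alcove u" "flip1 (alcove v)"]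
        qd_uminus[of "- flip1 (- alcove u)" "flip1 (alcove v)"] in
       \<open>simp_all add: alcove_mult_simple qbg_dist_eq qd_uminus
         flip: of_nat_less_iff[where 'a = int] of_nat_eq_iff[where 'a = int] del: weyl_refl_simps\<close>)
qed

section \<open>Length positivity\<close>

fun neg_root :: "root \<Rightarrow> root" where
  "neg_root (APlus n) = AMinus (- n)"
| "neg_root (AMinus n) = APlus (- n)"

lemma root_act_neg_root: "root_act w (neg_root \<beta>) = neg_root (root_act w \<beta>)"
  by (cases w; cases \<beta>) simp_all

lemma root_act_one [simp]: "root_act 1 \<beta> = \<beta>"
  by (cases \<beta>) (simp_all add: one_weyl_def)

lemma pos_ind_neg_root: "pos_ind (neg_root \<beta>) = 1 - pos_ind \<beta>"
  by (cases \<beta>) auto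

lemma length_fun_neg_root: "length_fun x (neg_root \<beta>) = - length_fun x \<beta>"
proof -
  obtain w \<mu> where x: "x = (w, \<mu>)" by (cases x)
  have "pairing (neg_root \<beta>) \<mu> = - pairing \<beta> \<mu>"
    by (cases \<beta>; cases \<mu>) simp_all
  with x show ?thesis by (simp add: root_act_neg_root pos_ind_neg_root)
qed

lemma length_fun_reflected:
  assumes "\<alpha> \<in> simple_roots"
  shows "length_fun x (root_act (v * weyl_refl \<alpha>) \<alpha>) = - length_fun x (root_act v \<alpha>)"
proof -
  have "root_act (weyl_refl \<alpha>) \<alpha> = neg_root \<alpha>"
    using assms by (cases rule: simple_rootsE) simp_all
  then show ?thesis
    by (simp add: root_act_mult root_act_neg_root length_fun_neg_root del: weyl_refl_simps)
qed

text \<open>The positive system of \<open>v\<close> consists of \<open>APlus n\<close> from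
  \<open>alcove v\<close> on and the negatives of the earlier ones. So length positivity locates a
  sign change of the sequence of lengths at \<open>APlus n\<close>.\<close>

lemma LP_alcove_iff:
  "v \<in> LP x \<longleftrightarrow> (\<forall>n\<ge>alcove v. length_fun x (APlus n) \<ge> 0) \<and>
    (\<forall>n<alcove v. length_fun x (APlus n) \<le> 0)"
proof -
  have "root_act v \<beta> \<in> APlus ` {alcove v..} \<union> (neg_root \<circ> APlus) ` {..<alcove v} \<longleftrightarrow> \<beta> \<in> pos_roots" for \<beta>
  proof -
    have "APlus n \<in> APlus ` {alcove v..} \<union> (neg_root \<circ> APlus) ` {..<alcove v} \<longleftrightarrow> n \<ge> alcove v"
      "AMinus n \<in> APlus ` {alcove v..} \<union> (neg_root \<circ> APlus) ` {..<alcove v} \<longleftrightarrow> - n < alcove v" for n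
      by (auto simp: image_iff intro: bexI[of _ "- n"])
    then show ?thesis by (cases v; cases \<beta>) (auto simp: pos_roots_def)
  qed
  moreover have "\<gamma> = root_act v (root_act (inverse v) \<gamma>)" for \<gamma>
    by (simp flip: root_act_mult)
  ultimately have "root_act v ` pos_roots = APlus ` {alcove v..} \<union> (neg_root \<circ> APlus) ` {..<alcove v}"
    by (metis (no_types, lifting) image_eqI image_iff subsetI subset_antisym)
  moreover have "v \<in> LP x \<longleftrightarrow> (\<forall>\<gamma>\<in>root_act v ` pos_roots. length_fun x \<gamma> \<ge> 0)"
    by (simp add: LP_def)
  ultimately show ?thesis
    by (auto simp: length_fun_neg_root ball_Un simp del: neg_root.simps)
qed

text \<open>The pairing has slope \<open>lev x\<close>. The two indicators jump at the fundamental
  alcove and at the alcove that \<open>x\<close> maps to it; only the latter jump is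
  downwards.\<close>

lemma length_fun_succ:
  "length_fun x (APlus (n + 1)) = length_fun x (APlus n) + lev x
     + (if n + 1 = 0 then 1 else 0) - (if n + 1 = alcove (inverse (fst x)) then 1 else 0)"
proof -
  obtain w k m l where x: "x = (w, k, m, l)" by (cases x) auto
  show ?thesis unfolding x by (cases w) (simp_all add: algebra_simps; presburger)+
qed

lemma length_fun_mono:
  assumes "lev x > 0" "n \<le> n'"
  shows "length_fun x (APlus n) \<le> length_fun x (APlus n')"
  using assms(2)
proof (induction n' rule: int_ge_induct)
  case (step i)
  then show ?case using length_fun_succ[of x i] assms(1) by auto
qed simp

text \<open>By monotonicity only the two values next to the sign change matter, and these belong to
  the two walls of \<open>v\<close>.\<close>

lemma LP_iff:
  assumes "lev x > 0"
  shows "v \<in> LP x \<longleftrightarrow> (\<forall>\<alpha>\<in>simple_roots. length_fun x (root_act v \<alpha>) \<ge> 0)"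
proof -
  have "(\<forall>\<alpha>\<in>simple_roots. length_fun x (root_act v \<alpha>) \<ge> 0) \<longleftrightarrow>
      length_fun x (APlus (alcove v)) \<ge> 0 \<and> length_fun x (neg_root (APlus (alcove v - 1))) \<ge> 0"
    by (cases v) (auto simp: simple_roots_def alpha0_def alpha1_def add.commute simp del: length_fun.simps)
  also have "\<dots> \<longleftrightarrow> v \<in> LP x"
    unfolding LP_alcove_iff length_fun_neg_root
    using length_fun_mono[OF assms] by (smt (verit))
  finally show ?thesis by simp
qed

lemma LP_simple:
  assumes "v \<in> LP x" "\<alpha> \<in> simple_roots"
  shows "length_fun x (root_act v \<alpha>) \<ge> 0"
  using assms two_rho_simple(2) by (auto simp: LP_def)

text \<open>The sign change may be placed on either side of a zero, and crossing the wall moves it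
  past exactly this one value.\<close>

lemma LP_reflected_iff:
  assumes "v \<in> LP x" "\<alpha> \<in> simple_roots"
  shows "v * weyl_refl \<alpha> \<in> LP x \<longleftrightarrow> length_fun x (root_act v \<alpha>) = 0"
proof
  assume "v * weyl_refl \<alpha> \<in> LP x"
  then show "length_fun x (root_act v \<alpha>) = 0"
    using LP_simple[OF assms] LP_simple[of "v * weyl_refl \<alpha>" x \<alpha>] assms(2)
    by (simp add: length_fun_reflected)
next
  assume 0: "length_fun x (root_act v \<alpha>) = 0"
  from simple_reflection_alcove[OF assms(2), of v] show "v * weyl_refl \<alpha> \<in> LP x"
  proof (elim disjE conjE)
    assume "root_act v \<alpha> = APlus (alcove v)" and a: "alcove (v * weyl_refl \<alpha>) = alcove v + 1"
    then have "length_fun x (APlus (alcove v)) = 0" using 0 by simp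
    then show ?thesis using assms(1) unfolding LP_alcove_iff a
      by (auto simp: zless_add1_eq le_less)
  next
    assume "root_act v \<alpha> = AMinus (1 - alcove v)" and a: "alcove (v * weyl_refl \<alpha>) = alcove v - 1"
    then have *: "length_fun x (APlus (alcove v - 1)) = 0"
      using 0 length_fun_neg_root[of x "APlus (alcove v - 1)"] by simp
    have "length_fun x (APlus n) \<ge> 0" if "n \<ge> alcove v - 1" for n
      using that assms(1) * unfolding LP_alcove_iff by (cases "n = alcove v - 1") auto
    then show ?thesis using assms(1) unfolding LP_alcove_iff a by auto
  qed
qed

lemma LP_nonempty:
  assumes "lev x > 0"
  shows "LP x \<noteq> {}"
proof -
  obtain w k m l where x: "x = (w, k, m, l)" by (cases x) auto
  define f where "f n = length_fun x (APlus n)" for n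
  \<comment> \<open>Chosen so that at level at least one the linear term outweighs
    \<open>2 * k\<close> and the indicators at both \<open>- M\<close> and \<open>M\<close>.\<close>
  define M where "M = 2 * \<bar>k\<bar> + 2"
  have "M * 1 \<le> M * l" using assms x by (intro mult_left_mono) (simp_all add: M_def)
  then have "M \<le> M * l" by simp
  have "f n = 2 * k + n * l + pos_ind (APlus n) - pos_ind (root_act w (APlus n))" for n
    by (simp add: f_def x del: pos_ind_simps)
  moreover have "0 \<le> pos_ind \<beta>" "pos_ind \<beta> \<le> 1" for \<beta>
    by (simp_all add: pos_ind_def)
  moreover have "M \<ge> 2 * k + 2" "M \<ge> 2 - 2 * k"
    by (simp_all add: M_def)
  ultimately have lo: "f (- M) < 0" and hi: "f M \<ge> 0"
    using \<open>M \<le> M * l\<close> by (smt (verit, best) mult_minus_left)+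
  have "\<exists>j. f (- M + int j) \<ge> 0"
    using hi by (intro exI[of _ "nat (2 * M)"]) (simp add: M_def)
  then obtain j where j: "f (- M + int j) \<ge> 0" "\<And>i. i < j \<Longrightarrow> f (- M + int i) < 0"
    using exists_least_iff[of "\<lambda>j. f (- M + int j) \<ge> 0"] by (metis not_le)
  then have "j > 0" using lo by (cases j) auto
  then have prev: "f (- M + int j - 1) < 0" using j(2)[of "j - 1"] by (simp add: of_nat_diff algebra_simps)
  obtain v where v: "alcove v = - M + int j" using alcove_surj by blast
  have "v \<in> LP x"
    unfolding LP_alcove_iff v f_def[symmetric]
  proof (intro conjI allI impI)
    fix n
    show "f n \<ge> 0" if "n \<ge> - M + int j"
      using length_fun_mono[OF assms that] j(1) unfolding f_def by linarith
    show "f n \<le> 0" if "n < - M + int j"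
      using length_fun_mono[OF assms, of n "- M + int j - 1"] that prev unfolding f_def by linarith
  qed
  then show ?thesis by blast
qed

section \<open>How far apart length positive alcoves can be\<close>

lemma LP_convex:
  assumes "v \<in> LP x" "v' \<in> LP x" "alcove v \<le> alcove w" "alcove w \<le> alcove v'"
  shows "w \<in> LP x"
  using assms unfolding LP_alcove_iff by auto

text \<open>At n the sequence passes from a nonnegative to a nonpositive value. By
  \<open>length_fun_succ\<close> an increment that is not positive requires level one and the
  downward jump alone.\<close>

lemma LP_gap:
  assumes "lev x > 0" "v \<in> LP x" "v' \<in> LP x" "alcove v < n" "n < alcove v'"
  shows "lev x = 1" "n \<noteq> 0" "n = alcove (inverse (fst x))"
proof -
  have "length_fun x (APlus (n - 1)) \<ge> 0" "length_fun x (APlus n) \<le> 0"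
    using assms unfolding LP_alcove_iff by auto
  then have "lev x = 1 \<and> n \<noteq> 0 \<and> n = alcove (inverse (fst x))"
    using length_fun_succ[of x "n - 1"] assms(1) by (auto split: if_splits)
  then show "lev x = 1" "n \<noteq> 0" "n = alcove (inverse (fst x))" by auto
qed

lemma LP_gap':
  assumes "lev x > 0" "v \<in> LP x" "v' \<in> LP x" "alcove v < alcove w" "alcove w < alcove v'"
  shows "lev x = 1" "alcove w \<noteq> 0" "fst x * w = 1"
  using LP_gap[OF assms] by simp_all

lemma LP_diameter:
  assumes "lev x > 0" "v \<in> LP x" "v' \<in> LP x"
  shows "\<bar>alcove v - alcove v'\<bar> \<le> 2" and "lev x > 1 \<Longrightarrow> \<bar>alcove v - alcove v'\<bar> \<le> 1"
proof -
  have "alcove v' - alcove v \<le> 2" "lev x > 1 \<Longrightarrow> alcove v' - alcove v \<le> 1"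
    if v: "v \<in> LP x" "v' \<in> LP x" for v v'
    using LP_gap(1,3)[OF assms(1) v, of "alcove v + 1"] LP_gap(3)[OF assms(1) v, of "alcove v + 2"]
    by linarith+
  from this[OF assms(2,3)] this[OF assms(3,2)]
  show "\<bar>alcove v - alcove v'\<bar> \<le> 2" and "lev x > 1 \<Longrightarrow> \<bar>alcove v - alcove v'\<bar> \<le> 1"
    by auto
qed

section \<open>The Demazure product\<close>

definition demazure_val :: "daw \<Rightarrow> daw \<Rightarrow> weyl \<Rightarrow> weyl \<Rightarrow> daw" where
  "demazure_val x y u v = (fst x * u * inverse v,
     cw_act (v * inverse u) (snd x) + snd y - cw_act v (qbg_wt u (fst y * v)))"

lemma demazure_values_eq:
  "demazure_values x y = {demazure_val x y u v |u v. (u, v) \<in> min_pairs x y}"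
proof -
  have "demazure_at x y u v p = demazure_val x y u v" if "shortest_qbg_path u p (fst y * v)" for u v p
    using shortest_qbg_path_wt[OF that] by (cases x; cases y) (simp add: demazure_val_def)
  then show ?thesis
    unfolding demazure_values_def by (intro Collect_cong) (metis shortest_qbg_path_exists)
qed

lemma min_pairsD:
  assumes "(u, v) \<in> min_pairs x y"
  shows "u \<in> LP x" "v \<in> LP y"
    "\<And>u' v'. u' \<in> LP x \<Longrightarrow> v' \<in> LP y \<Longrightarrow> qbg_dist u (fst y * v) \<le> qbg_dist u' (fst y * v')"
  using assms by (auto simp: min_pairs_def)

lemma min_pairsI:
  assumes "u \<in> LP x" "v \<in> LP y"
    and "\<And>u' v'. u' \<in> LP x \<Longrightarrow> v' \<in> LP y \<Longrightarrow> qbg_dist u (fst y * v) \<le> qbg_dist u' (fst y * v')"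
  shows "(u, v) \<in> min_pairs x y"
  using assms by (simp add: min_pairs_def)

lemma min_pairs_eq_dist:
  assumes "(u, v) \<in> min_pairs x y" "u' \<in> LP x" "v' \<in> LP y"
  shows "(u', v') \<in> min_pairs x y \<longleftrightarrow> qbg_dist u' (fst y * v') = qbg_dist u (fst y * v)"
proof
  assume "(u', v') \<in> min_pairs x y"
  then show "qbg_dist u' (fst y * v') = qbg_dist u (fst y * v)"
    using min_pairsD[OF assms(1)] min_pairsD[of u' v' x y] assms(2,3) by (intro le_antisym)
next
  assume "qbg_dist u' (fst y * v') = qbg_dist u (fst y * v)"
  then show "(u', v') \<in> min_pairs x y"
    using min_pairsD(3)[OF assms(1)] assms(2,3) unfolding min_pairs_def by simp
qed

lemma min_pairs_nonempty:
  assumes "lev x > 0" "lev y > 0"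
  shows "\<exists>u v. (u, v) \<in> min_pairs x y"
proof -
  define P where "P n \<longleftrightarrow> (\<exists>u\<in>LP x. \<exists>v\<in>LP y. qbg_dist u (fst y * v) = n)" for n
  have "\<exists>n. P n"
    using LP_nonempty[OF assms(1)] LP_nonempty[OF assms(2)] unfolding P_def by blast
  then obtain n where "P n" "\<And>i. i < n \<Longrightarrow> \<not> P i"
    using exists_least_iff[of P] by blast
  then obtain u v where "u \<in> LP x" "v \<in> LP y" "qbg_dist u (fst y * v) = n"
    unfolding P_def by blast
  moreover have "n \<le> qbg_dist u' (fst y * v')" if "u' \<in> LP x" "v' \<in> LP y" for u' v'
    using that \<open>\<And>i. i < n \<Longrightarrow> \<not> P i\<close> unfolding P_def by (metis not_le)
  ultimately show ?thesis
    unfolding min_pairs_def by blast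
qed

text \<open>Crossing a wall changes the distance by exactly one, and minimality excludes the
  decrease.\<close>

lemma min_pairs_step:
  assumes "(u, v) \<in> min_pairs x y" "\<alpha> \<in> simple_roots"
  shows "u * weyl_refl \<alpha> \<in> LP x \<Longrightarrow>
      qbg_dist (u * weyl_refl \<alpha>) (fst y * v) = qbg_dist u (fst y * v) + 1"
    and "v * weyl_refl \<alpha> \<in> LP y \<Longrightarrow>
      qbg_dist u (fst y * v * weyl_refl \<alpha>) = qbg_dist u (fst y * v) + 1"
  using min_pairsD[OF assms(1)] qbg_dist_adjacent[OF assms(2), of u "fst y * v"]
  by (metis Suc_eq_plus1 not_less_eq_eq le_refl mult.assoc)+

lemma cw_scale_diff_left: "cw_scale (a - b) \<mu> = cw_scale a \<mu> - cw_scale b \<mu>"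
  by (cases \<mu>) (simp add: algebra_simps)

text \<open>The mixed pair \<open>(u * s, b)\<close> is one edge further apart than both minimal
  pairs. Comparing its weight with theirs, and using that the excess is zero, shows that the two
  weights correspond under \<open>s\<close>; this cancels against the factor \<open>s\<close> in the
  second component.\<close>

lemma demazure_val_reflected:
  assumes "(u, v) \<in> min_pairs x y" "(u * weyl_refl \<alpha>, v * weyl_refl \<alpha>) \<in> min_pairs x y"
    and \<alpha>: "\<alpha> \<in> simple_roots"
  shows "demazure_val x y (u * weyl_refl \<alpha>) (v * weyl_refl \<alpha>) = demazure_val x y u v"
proof -
  define b s where "b = fst y * v" and "s = weyl_refl \<alpha>"
  have s: "s * s = 1" "inverse s = s" "w * s * s = w" for w
    using weyl_refl_involution[OF \<alpha>] by (simp_all add: s_def)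
  have us: "u * s \<in> LP x" and vs: "v * s \<in> LP y"
    using min_pairsD(1,2)[OF assms(2)] by (simp_all add: s_def)
  have dist: "qbg_dist (u * s) b = qbg_dist u b + 1" "qbg_dist u (b * s) = qbg_dist u b + 1"
    using min_pairs_step[OF assms(1) \<alpha>] us vs by (simp_all add: s_def b_def)
  have diag: "qbg_dist (u * s) (b * s) = qbg_dist u b"
    using min_pairs_eq_dist[OF assms(1) us vs] assms(2) by (simp add: s_def b_def mult.assoc)
  have "excess \<alpha> u b = 0"
    using excess_eq_0_iff[OF \<alpha>, of u b] dist diag by (simp add: s_def)
  then have pair: "pairing \<alpha> (qbg_wt u b) = pos_ind (root_act b \<alpha>) - pos_ind (root_act u \<alpha>)"
    by (simp add: excess_def)
  have "qbg_wt (u * s) b = qbg_wt u b + cw_scale (pos_ind (root_act u \<alpha>)) (coroot \<alpha>)"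
    using qbg_wt_left[OF \<alpha>] dist(1) by (simp add: s_def)
  moreover have "qbg_wt (u * s) b = qbg_wt (u * s) (b * s) + cw_scale (pos_ind (root_act b \<alpha>)) (coroot \<alpha>)"
    using qbg_wt_right[OF \<alpha>, of "u * s" "b * s"] dist(1) diag pos_ind_simple_reflected[OF \<alpha>, of b]
    by (simp add: s(3) flip: s_def)
  ultimately have "qbg_wt (u * s) (b * s) = qbg_wt u b - cw_scale (pairing \<alpha> (qbg_wt u b)) (coroot \<alpha>)"
    unfolding pair cw_scale_diff_left by (simp add: algebra_simps)
  then have "qbg_wt (u * s) (b * s) = cw_act s (qbg_wt u b)"
    by (simp add: s_def cw_act_weyl_refl reflection_def)
  then have "cw_act (v * s) (qbg_wt (u * s) (fst y * (v * s))) = cw_act v (qbg_wt u b)"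
    by (simp add: b_def mult.assoc s flip: cw_act_mult)
  then show ?thesis
    unfolding demazure_val_def by (simp add: inverse_weyl_mult mult.assoc s b_def flip: s_def)
      (simp add: s flip: mult.assoc)
qed

text \<open>
  At level one, \<open>LP x\<close> may contain three consecutive alcoves. The middle one is then not the fundamental alcove but
  is mapped to it by \<open>x\<close>, and in this position two minimal pairs cannot be two steps apart.
\<close>

lemma qd_wide_left: "m \<noteq> 0 \<Longrightarrow> qd (m - 1) q = qd (m + 1) q \<Longrightarrow> qd (m + 1) q < qd m q + 1 \<Longrightarrow> False"
  by (cases "m > 0"; cases "q > 0"; cases "q < 0"; cases "\<bar>q\<bar> \<le> \<bar>m\<bar>"; auto simp: qd_def split: if_splits)

lemma qd_wide_right: "qd p (- 1) = qd p 1 \<Longrightarrow> qd p 1 \<le> qd p 0 \<Longrightarrow> False"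
  by (cases "p > 0"; cases "p < 0"; auto simp: qd_def split: if_splits)

lemma qd_wide_both:
  assumes "m \<noteq> 0" "\<bar>e\<bar> = 1" "\<bar>f\<bar> = 1"
  shows "qd (m + e) f + qd (m - e) (- f) \<ge> 2 * \<bar>m\<bar>"
proof -
  have "e = 1 \<or> e = -1" "f = 1 \<or> f = -1"
    using assms(2,3) by auto
  then show ?thesis
    using assms(1) by (cases "m > 0"; elim disjE; simp add: qd_def)
qed

section \<open>Independence of the minimal pair\<close>

lemma LP_two_apart:
  assumes "lev x > 0" "u \<in> LP x" "u' \<in> LP x" "\<bar>alcove u - alcove u'\<bar> = 2"
  obtains w e where "w \<in> LP x" "alcove w \<noteq> 0" "fst x * w = 1" "\<bar>e\<bar> = 1"
    "alcove u = alcove w + e" "alcove u' = alcove w - e"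
proof -
  have mid: "w \<in> LP x \<and> alcove w \<noteq> 0 \<and> fst x * w = 1"
    if "u1 \<in> LP x" "u2 \<in> LP x" "alcove u1 < alcove w" "alcove w < alcove u2" for u1 u2 w
    using LP_convex[OF that(1,2), of w] LP_gap'[OF assms(1) that] that(3,4) by simp
  have "alcove u' = alcove u + 2 \<or> alcove u = alcove u' + 2" using assms(4) by linarith
  then show thesis
  proof
    assume *: "alcove u' = alcove u + 2"
    obtain w where w: "alcove w = alcove u + 1" using alcove_surj by blast
    show thesis
      by (rule that[of w "-1"]) (use mid[OF assms(2,3), of w] w * in \<open>simp_all\<close>)
  next
    assume *: "alcove u = alcove u' + 2"
    obtain w where w: "alcove w = alcove u' + 1" using alcove_surj by blast
    show thesis
      by (rule that[of w 1]) (use mid[OF assms(3,2), of w] w * in \<open>simp_all\<close>)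
  qed
qed

text \<open>Equal distances force displacements of equal parity in both components, and
  \<open>LP_diameter\<close> bounds them by two. Either both are one, and then come from the same
  simple root, or a displacement by two contradicts minimality.\<close>

lemma demazure_val_unique:
  assumes lev: "lev x > 0" "lev y > 0"
    and M: "(u, v) \<in> min_pairs x y" and M': "(u', v') \<in> min_pairs x y"
  shows "demazure_val x y u v = demazure_val x y u' v'"
proof -
  note D = min_pairsD[OF M] and D' = min_pairsD[OF M']
  define b where "b v = alcove (fst y * v)" for v
  have eq: "qd (alcove u) (b v) = qd (alcove u') (b v')"
    using min_pairs_eq_dist[OF M D'(1,2)] M' by (simp add: b_def flip: qbg_dist_eq)
  have min: "qd (alcove u) (b v) \<le> qd (alcove u'') (b v'')" if "u'' \<in> LP x" "v'' \<in> LP y" for u'' v''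
    using D(3)[OF that] by (simp add: b_def flip: qbg_dist_eq)
  have b_diff: "\<bar>b v - b v'\<bar> = \<bar>alcove v - alcove v'\<bar>" for v v'
    by (simp add: b_def alcove_mult abs_minus_commute)
  have par: "even (alcove u - alcove u') \<longleftrightarrow> even (alcove v - alcove v')"
  proof -
    have "even (alcove u - b v) \<longleftrightarrow> even (alcove u' - b v')"
      using eq qd_even by metis
    moreover have "even (b v - b v') \<longleftrightarrow> even (alcove v - alcove v')"
      using b_diff[of v v'] by (metis dvd_abs_iff)
    ultimately show ?thesis by presburger
  qed
  have le2: "\<bar>alcove u - alcove u'\<bar> \<le> 2" "\<bar>alcove v - alcove v'\<bar> \<le> 2"
    using LP_diameter(1) lev D D' by blast+
  have cases2: "i = 0 \<and> even i \<or> \<bar>i\<bar> = 1 \<and> odd i \<or> \<bar>i\<bar> = 2 \<and> even i" if "\<bar>i\<bar> \<le> 2" for i :: int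
  proof -
    have "i \<in> {-2, -1, 0, 1, 2}"
      using that by auto
    then show ?thesis by auto
  qed
  \<comment> \<open>An elimination rule: \<open>y\<close> maps the middle alcove of
    \<open>LP y\<close> to 0, hence the outer two to 1 and -1.\<close>
  have v2: P
    if two: "\<bar>alcove v - alcove v'\<bar> = 2"
      and step: "\<And>w f. w \<in> LP y \<Longrightarrow> \<bar>f\<bar> = 1 \<Longrightarrow> b w = 0 \<Longrightarrow> b v = f \<Longrightarrow> b v' = - f \<Longrightarrow> P" for P
  proof -
    obtain w e where w: "w \<in> LP y" "fst y * w = 1" "\<bar>e\<bar> = 1" "alcove v = alcove w + e" "alcove v' = alcove w - e"
      using LP_two_apart[OF lev(2) D(2) D'(2) two] by metis
    have "b w = 0" using w(2) by (simp add: b_def)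
    moreover from this have "b v = (if even (alcove (fst y)) then e else - e)" "b v' = - b v"
      using w(4,5) by (auto simp: b_def alcove_mult)
    ultimately show P using step[OF w(1), of "b v"] w(3) by auto
  qed
  consider "alcove u = alcove u'" "alcove v = alcove v'"
    | "\<bar>alcove u - alcove u'\<bar> = 1" "\<bar>alcove v - alcove v'\<bar> = 1"
    | "\<bar>alcove u - alcove u'\<bar> = 2" "alcove v = alcove v'"
    | "alcove u = alcove u'" "\<bar>alcove v - alcove v'\<bar> = 2"
    | "\<bar>alcove u - alcove u'\<bar> = 2" "\<bar>alcove v - alcove v'\<bar> = 2"
    using cases2[OF le2(1)] cases2[OF le2(2)] par by (auto simp del: even_diff even_add)
  then show ?thesis
  proof cases
    case 1
    then show ?thesis by simp
  next
    case 2
    obtain \<alpha> where \<alpha>: "\<alpha> \<in> simple_roots" "u' = u * weyl_refl \<alpha>"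
      using alcove_adjacent[OF 2(1)] by blast
    obtain \<beta> where \<beta>: "\<beta> \<in> simple_roots" "v' = v * weyl_refl \<beta>"
      using alcove_adjacent[OF 2(2)] by blast
    have "\<alpha> = \<beta>"
    proof (rule ccontr)
      assume "\<alpha> \<noteq> \<beta>"
      then have "qbg_dist u' (fst y * v') \<noteq> qbg_dist u (fst y * v)"
        using qbg_dist_distinct_reflections[OF \<alpha>(1) \<beta>(1), of u "fst y * v"]
          min_pairs_step(1)[OF M \<alpha>(1)] min_pairs_step(2)[OF M \<beta>(1)] D'(1,2) \<alpha> \<beta>
        by (simp add: mult.assoc)
      then show False using min_pairs_eq_dist[OF M D'(1,2)] M' by simp
    qed
    then show ?thesis
      using demazure_val_reflected[of u v x y \<alpha>] M M' \<alpha> \<beta> by simp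
  next
    case 3
    obtain w e where w: "w \<in> LP x" "alcove w \<noteq> 0" "\<bar>e\<bar> = 1" "alcove u = alcove w + e" "alcove u' = alcove w - e"
      using LP_two_apart[OF lev(1) D(1) D'(1) 3(1)] by metis
    have "qd (alcove w - 1) (b v) = qd (alcove w + 1) (b v)" "qd (alcove w + 1) (b v) < qd (alcove w) (b v) + 1"
      using eq min[OF w(1) D(2)] w(3-5) 3(2) by (auto simp: abs_if split: if_splits)
    then show ?thesis using qd_wide_left w(2) by blast
  next
    case 4
    obtain w f where "w \<in> LP y" "\<bar>f\<bar> = 1" "b w = 0" "b v = f" "b v' = - f"
      using v2[OF 4(2)] by metis
    then have "qd (alcove u) (- 1) = qd (alcove u) 1" "qd (alcove u) 1 \<le> qd (alcove u) 0"
      using eq min[OF D(1), of w] 4(1) by (auto simp: abs_if split: if_splits)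
    then show ?thesis using qd_wide_right by blast
  next
    case 5
    obtain w e where w: "w \<in> LP x" "alcove w \<noteq> 0" "\<bar>e\<bar> = 1" "alcove u = alcove w + e" "alcove u' = alcove w - e"
      using LP_two_apart[OF lev(1) D(1) D'(1) 5(1)] by metis
    obtain w' f where w': "w' \<in> LP y" "\<bar>f\<bar> = 1" "b w' = 0" "b v = f" "b v' = - f"
      using v2[OF 5(2)] by metis
    \<comment> \<open>The neighbour of 0 on the side of \<open>w\<close>. It is reached from
      \<open>w\<close> by descending, which is cheaper than the average of the two given
      distances.\<close>
    define g where "g = sgn (alcove w)"
    have "g = f \<or> g = - f"
      using w(2) w'(2) by (auto simp: g_def sgn_if)
    then obtain v'' where v'': "v'' \<in> LP y" "b v'' = g"
      using w' D(2) D'(2) by metis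
    have "qd (alcove w) g = \<bar>alcove w\<bar> - 1"
      using w(2) by (auto simp: g_def qd_def sgn_if)
    then have "qd (alcove w + e) f \<le> \<bar>alcove w\<bar> - 1"
      using min[OF w(1) v''(1)] v''(2) w(4) w'(4) by simp
    moreover have "2 * \<bar>alcove w\<bar> \<le> 2 * qd (alcove w + e) f"
      using qd_wide_both[OF w(2,3) w'(2)] eq w(4,5) w'(4,5) by simp
    ultimately show ?thesis by simp
  qed
qed

lemma demazure_eq:
  assumes "lev x > 0" "lev y > 0" "(u, v) \<in> min_pairs x y"
  shows "demazure_values x y = {demazure_val x y u v}" "demazure x y = demazure_val x y u v"
proof -
  show "demazure_values x y = {demazure_val x y u v}"
    unfolding demazure_values_eq using demazure_val_unique[OF assms(1,2)] assms(3) by blast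
  then show "demazure x y = demazure_val x y u v"
    by (simp add: demazure_def)
qed

section \<open>Level and length positivity of the product\<close>

lemma lev_demazure_val: "lev (demazure_val x y u v) = lev x + lev y"
  by (simp add: lev_eq demazure_val_def cw_act_level qbg_wt_def qwt_level)

lemma W_T_iff: "lev x > 0 \<Longrightarrow> x \<in> W_T"
  by (cases x rule: lev.cases) (auto simp: W_T_def tits_cone_def)

lemma W_T_lev: "x \<in> W_T \<Longrightarrow> lev x \<noteq> 0 \<Longrightarrow> lev x > 0"
  by (cases x rule: lev.cases) (auto simp: W_T_def tits_cone_def)

lemma fst_demazure_val_mult: "fst (demazure_val x y u v) * v = fst x * u"
  by (simp add: demazure_val_def mult.assoc)

text \<open>The outer indicators agree on both sides. Those of \<open>u\<close> and of
  \<open>fst y * v\<close> at \<alpha> do not cancel, and together with the pairing of the path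
  weight they form the excess.\<close>

lemma length_fun_demazure_val:
  "length_fun (demazure_val x y u v) (root_act v \<alpha>) =
     length_fun x (root_act u \<alpha>) + length_fun y (root_act v \<alpha>) + excess \<alpha> u (fst y * v)"
proof -
  obtain w \<mu> where x: "x = (w, \<mu>)" by (cases x)
  obtain w' \<mu>' where y: "y = (w', \<mu>')" by (cases y)
  have "pairing (root_act v \<alpha>) (cw_act (v * inverse u) \<mu>) = pairing (root_act u \<alpha>) \<mu>"
    using pairing_invariant[of "v * inverse u" "root_act u \<alpha>" \<mu>]
    by (simp add: mult.assoc flip: root_act_mult)
  then show ?thesis
    by (simp add: x y demazure_val_def excess_def pairing_add pairing_diff pairing_invariant
        mult.assoc flip: root_act_mult)
qed

text \<open>A negative excess is -1, and then both other summands are at least 1. So the sum is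
  nonnegative and vanishes only if all three terms do, in which case crossing both walls preserves
  the minimal distance.\<close>

lemma LP_demazure_val_reflected:
  assumes M: "(u, v) \<in> min_pairs x y" and \<alpha>: "\<alpha> \<in> simple_roots"
  shows "length_fun (demazure_val x y u v) (root_act v \<alpha>) \<ge> 0"
    and "length_fun (demazure_val x y u v) (root_act v \<alpha>) = 0 \<Longrightarrow>
      (u * weyl_refl \<alpha>, v * weyl_refl \<alpha>) \<in> min_pairs x y"
proof -
  define b where "b = fst y * v"
  note D = min_pairsD[OF M]
  have nonneg: "length_fun x (root_act u \<alpha>) \<ge> 0" "length_fun y (root_act v \<alpha>) \<ge> 0"
    using LP_simple D(1,2) \<alpha> by blast+
  note sum = length_fun_demazure_val[of x y u v \<alpha>, folded b_def]
  have farther: "qbg_dist u b < qbg_dist (u * weyl_refl \<alpha>) b" if "length_fun x (root_act u \<alpha>) = 0"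
    using min_pairs_step(1)[OF M \<alpha>] LP_reflected_iff[OF D(1) \<alpha>] that by (simp add: b_def)
  have farther': "qbg_dist u b < qbg_dist u (b * weyl_refl \<alpha>)" if "length_fun y (root_act v \<alpha>) = 0"
    using min_pairs_step(2)[OF M \<alpha>] LP_reflected_iff[OF D(2) \<alpha>] that by (simp add: b_def)
  have pos: "length_fun (demazure_val x y u v) (root_act v \<alpha>) > 0" if "excess \<alpha> u b < 0"
  proof -
    note E = excess_neg[OF \<alpha> that]
    have "length_fun x (root_act u \<alpha>) \<noteq> 0" "length_fun y (root_act v \<alpha>) \<noteq> 0"
      using farther farther' E(2,3) by auto
    with nonneg E(1) show ?thesis unfolding sum by linarith
  qed
  then show "length_fun (demazure_val x y u v) (root_act v \<alpha>) \<ge> 0"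
    using nonneg unfolding sum by linarith
  show "(u * weyl_refl \<alpha>, v * weyl_refl \<alpha>) \<in> min_pairs x y"
    if "length_fun (demazure_val x y u v) (root_act v \<alpha>) = 0"
  proof -
    have 0: "length_fun x (root_act u \<alpha>) = 0" "length_fun y (root_act v \<alpha>) = 0" "excess \<alpha> u b = 0"
      using that pos nonneg unfolding sum by linarith+
    then have "qbg_dist (u * weyl_refl \<alpha>) (b * weyl_refl \<alpha>) = qbg_dist u b"
      using excess_eq_0_iff[OF \<alpha>] farther farther' by blast
    moreover have "u * weyl_refl \<alpha> \<in> LP x" "v * weyl_refl \<alpha> \<in> LP y"
      using LP_reflected_iff D(1,2) \<alpha> 0 by blast+
    ultimately show ?thesis
      using min_pairs_eq_dist[OF M] by (simp add: b_def mult.assoc)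
  qed
qed

text \<open>The product has level at least two, so apart from a known \<open>v\<close> only one
  adjacent alcove can be length positive, and it comes from a reflected minimal pair.\<close>

lemma LP_demazure:
  assumes "lev x > 0" "lev y > 0" "lev x + lev y > 1"
  shows "LP (demazure x y) = snd ` min_pairs x y"
proof -
  have member: "v \<in> LP (demazure x y)" if "(u, v) \<in> min_pairs x y" for u v
    using LP_demazure_val_reflected(1)[OF that] LP_iff[of "demazure x y" v] assms
    by (simp add: demazure_eq(2)[OF assms(1,2) that] lev_demazure_val)
  obtain u v where M: "(u, v) \<in> min_pairs x y"
    using min_pairs_nonempty assms by blast
  note eq = demazure_eq(2)[OF assms(1,2) M]
  have "v' \<in> snd ` min_pairs x y" if v': "v' \<in> LP (demazure x y)" for v'
  proof (cases "v' = v")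
    case True
    then show ?thesis using M by force
  next
    case False
    have "\<bar>alcove v - alcove v'\<bar> \<le> 1"
      using LP_diameter(2)[OF _ member[OF M] v'] assms by (simp add: eq lev_demazure_val)
    moreover have "alcove v \<noteq> alcove v'" using False by simp
    ultimately have "\<bar>alcove v - alcove v'\<bar> = 1" by linarith
    then obtain \<alpha> where \<alpha>: "\<alpha> \<in> simple_roots" "v' = v * weyl_refl \<alpha>"
      using alcove_adjacent by blast
    then have "length_fun (demazure x y) (root_act v \<alpha>) = 0"
      using LP_reflected_iff[OF member[OF M] \<alpha>(1)] v' by simp
    then have "(u * weyl_refl \<alpha>, v') \<in> min_pairs x y"
      using LP_demazure_val_reflected(2)[OF M \<alpha>(1)] \<alpha>(2) by (simp add: eq)
    then show ?thesis by force
  qed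
  with member show ?thesis by force
qed

lemma demazure_assoc_common:
  assumes lev: "lev x > 0" "lev y > 0" "lev z > 0"
    and xy: "(u, v) \<in> min_pairs x y" and yz: "(v', t) \<in> min_pairs y z"
    and xyz: "(v, t) \<in> min_pairs (demazure x y) z" "(u, t) \<in> min_pairs x (demazure y z)"
    and wt: "cw_act (inverse v) (snd y) - qbg_wt u (fst y * v) - qbg_wt v (fst z * t) =
      cw_act (inverse v') (snd y) - qbg_wt u (fst y * v') - qbg_wt v' (fst z * t)"
  shows "demazure (demazure x y) z = demazure x (demazure y z)"
proof -
  note exy = demazure_eq(2)[OF lev(1,2) xy] and eyz = demazure_eq(2)[OF lev(2,3) yz]
  have "lev (demazure x y) > 0" "lev (demazure y z) > 0"
    using lev by (simp_all add: exy eyz lev_demazure_val)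
  then have e1: "demazure (demazure x y) z = demazure_val (demazure_val x y u v) z v t"
    and e2: "demazure x (demazure y z) = demazure_val x (demazure_val y z v' t) u t"
    using demazure_eq(2) lev xyz unfolding exy eyz by simp_all
  have swap: "cw_act (t * inverse v) (snd y) - cw_act t (qbg_wt u (fst y * v)) - cw_act t (qbg_wt v (fst z * t)) =
      cw_act (t * inverse v') (snd y) - cw_act t (qbg_wt u (fst y * v')) - cw_act t (qbg_wt v' (fst z * t))"
    using arg_cong[OF wt, of "cw_act t"] by (simp add: cw_act_diff cw_act_mult)
  \<comment> \<open>With the same \<open>u\<close> and \<open>t\<close> the Weyl components and the
    contributions of \<open>x\<close> and \<open>z\<close> agree; only the part collected in
    \<open>wt\<close> is left to compare.\<close>
  have "fst (demazure_val (demazure_val x y u v) z v t) = fst (demazure_val x (demazure_val y z v' t) u t)"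
    by (simp add: demazure_val_def mult.assoc)
  moreover have "snd (demazure_val (demazure_val x y u v) z v t) =
      cw_act (t * inverse u) (snd x) + snd z +
      (cw_act (t * inverse v) (snd y) - cw_act t (qbg_wt u (fst y * v)) - cw_act t (qbg_wt v (fst z * t)))"
    by (simp add: demazure_val_def cw_act_add cw_act_diff mult.assoc flip: cw_act_mult)
  moreover have "snd (demazure_val x (demazure_val y z v' t) u t) =
      cw_act (t * inverse u) (snd x) + snd z +
      (cw_act (t * inverse v') (snd y) - cw_act t (qbg_wt u (fst y * v')) - cw_act t (qbg_wt v' (fst z * t)))"
    by (simp add: demazure_val_def mult.assoc)
  ultimately show ?thesis
    unfolding e1 e2 using swap by (simp add: prod_eq_iff)
qed

text \<open>
  If the minimal pairs for \<open>(x, y)\<close> and for \<open>(y, z)\<close> have no common \<open>v \<in> LP y\<close>, then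
  \<open>LP y = {v, v s\<^sub>\<alpha>}\<close>, and the two bracketings traverse the edge between \<open>v\<close> and \<open>v s\<^sub>\<alpha>\<close> in different
  factors; its weights are compensated by \<open>\<langle>v\<alpha>, \<mu>\<^sub>y\<rangle>\<close>, which \<open>length_fun y (v\<alpha>) = 0\<close> determines.
\<close>

lemma demazure_assoc:
  assumes lev: "lev x > 1" "lev y > 1" "lev z > 1"
  shows "demazure (demazure x y) z = demazure x (demazure y z)"
proof -
  have LP: "LP (demazure x y) = snd ` min_pairs x y" "LP (demazure y z) = snd ` min_pairs y z"
    using LP_demazure lev by simp_all
  have fst_yz: "fst (demazure y z) * t = fst y * v" if "(v, t) \<in> min_pairs y z" for v t
    using demazure_eq(2)[of y z, OF _ _ that] lev by (simp add: fst_demazure_val_mult)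
  have LPI: "v \<in> LP (demazure x y)" if "(u, v) \<in> min_pairs x y" for u v
    unfolding LP using that by force
  have LPI': "t \<in> LP (demazure y z)" if "(v, t) \<in> min_pairs y z" for v t
    unfolding LP using that by force
  have LPE: "\<exists>u. (u, v) \<in> min_pairs x y" if "v \<in> LP (demazure x y)" for v
    using that unfolding LP by force
  have LPE': "\<exists>v. (v, t) \<in> min_pairs y z" if "t \<in> LP (demazure y z)" for t
    using that unfolding LP by force
  show ?thesis
  proof (cases "\<exists>u v t. (u, v) \<in> min_pairs x y \<and> (v, t) \<in> min_pairs y z")
    case True
    then obtain u v t where xy: "(u, v) \<in> min_pairs x y" and yz: "(v, t) \<in> min_pairs y z"
      by blast
    \<comment> \<open>\<open>LP (demazure x y)\<close> is a part of \<open>LP y\<close> containing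
      \<open>v\<close>, so minimality is inherited.\<close>
    have "(v, t) \<in> min_pairs (demazure x y) z"
      using LPI[OF xy] min_pairsD[OF yz] LPE min_pairsD(2)[of _ _ x y] by (intro min_pairsI) blast+
    moreover have "(u, t) \<in> min_pairs x (demazure y z)"
    proof (rule min_pairsI)
      show "u \<in> LP x" "t \<in> LP (demazure y z)"
        using min_pairsD(1)[OF xy] LPI'[OF yz] by simp_all
      fix u' t' assume "u' \<in> LP x" "t' \<in> LP (demazure y z)"
      moreover from this obtain v' where "(v', t') \<in> min_pairs y z" using LPE' by blast
      \<comment> \<open>By \<open>fst_yz\<close> the target is \<open>fst y * v'\<close>, so the
        distance is one of those minimised for \<open>(x, y)\<close>.\<close>
      ultimately show "qbg_dist u (fst (demazure y z) * t) \<le> qbg_dist u' (fst (demazure y z) * t')"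
        using fst_yz yz min_pairsD(3)[OF xy] min_pairsD(1) by metis
    qed
    ultimately show ?thesis
      using demazure_assoc_common[OF _ _ _ xy yz] lev by simp
  next
    case False
    obtain u v where xy: "(u, v) \<in> min_pairs x y"
      using min_pairs_nonempty[of x y] lev by auto
    obtain v' t where yz: "(v', t) \<in> min_pairs y z"
      using min_pairs_nonempty[of y z] lev by auto
    note Dxy = min_pairsD[OF xy] and Dyz = min_pairsD[OF yz]
    have ne: "v'' \<noteq> v'" if "(u'', v'') \<in> min_pairs x y" for u'' v'' using False yz that by blast
    have ne': "v'' \<noteq> v" if "(v'', t'') \<in> min_pairs y z" for v'' t'' using False xy that by blast
    have adj: "\<bar>alcove p - alcove q\<bar> \<le> 1" if "p \<in> LP y" "q \<in> LP y" for p q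
      using LP_diameter(2)[OF _ that] lev by simp
    have neq: "alcove v \<noteq> alcove v'" using ne[OF xy] by simp
    have LPy: "p = v \<or> p = v'" if "p \<in> LP y" for p
    proof -
      have "alcove p = alcove v \<or> alcove p = alcove v'"
        using adj[OF that Dxy(2)] adj[OF that Dyz(1)] adj[OF Dxy(2) Dyz(1)] neq by linarith
      then show ?thesis by simp
    qed
    have "\<bar>alcove v - alcove v'\<bar> = 1" using adj[OF Dxy(2) Dyz(1)] neq by linarith
    then obtain \<alpha> where \<alpha>: "\<alpha> \<in> simple_roots" and v': "v' = v * weyl_refl \<alpha>"
      using alcove_adjacent by blast
    define b c where "b = fst y * v" and "c = fst z * t"
    have v: "v = v' * weyl_refl \<alpha>" using weyl_refl_involution(3)[OF \<alpha>] by (simp add: v')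
    have b': "fst y * v' = b * weyl_refl \<alpha>" by (simp add: b_def v' mult.assoc)
    have d1: "qbg_dist u (b * weyl_refl \<alpha>) = qbg_dist u b + 1"
      using min_pairs_step(2)[OF xy \<alpha>] Dyz(1) by (simp add: v' b_def)
    have d2: "qbg_dist v c = qbg_dist v' c + 1"
      using min_pairs_step(1)[OF yz \<alpha>] Dxy(2) v by (simp add: c_def)
    have snd_xy: "v'' = v" if "(u'', v'') \<in> min_pairs x y" for u'' v''
      using LPy[OF min_pairsD(2)[OF that]] ne[OF that] by blast
    have fst_eq: "v'' = v'" if "(v'', t'') \<in> min_pairs y z" for v'' t''
      using LPy[OF min_pairsD(1)[OF that]] ne'[OF that] by blast
    \<comment> \<open>Attaining the minimum for \<open>(y, z)\<close> from \<open>v\<close> would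
      produce a common \<open>v\<close>, so every such distance exceeds it by at least one, which is
      exactly the excess at \<open>c\<close>. The bound for \<open>u'\<close> below is the mirror
      argument for \<open>(x, y)\<close>.\<close>
    have "qbg_dist v c \<le> qbg_dist v (fst z * t')" if "t' \<in> LP z" for t'
    proof -
      have "qbg_dist v (fst z * t') \<noteq> qbg_dist v' c"
        using min_pairs_eq_dist[OF yz Dxy(2) that] ne' by (auto simp: c_def)
      then show ?thesis using Dyz(3)[OF Dxy(2) that] d2 by (simp add: c_def)
    qed
    then have xyz: "(v, t) \<in> min_pairs (demazure x y) z"
      using LPI[OF xy] Dyz(2) LPE snd_xy by (intro min_pairsI) (metis c_def)+
    have "qbg_dist u (b * weyl_refl \<alpha>) \<le> qbg_dist u' (b * weyl_refl \<alpha>)" if "u' \<in> LP x" for u'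
    proof -
      have "qbg_dist u' (b * weyl_refl \<alpha>) \<noteq> qbg_dist u b"
        using min_pairs_eq_dist[OF xy that Dyz(1)] ne by (auto simp: b_def v' mult.assoc)
      then show ?thesis using Dxy(3)[OF that Dyz(1)] d1 by (simp add: b' flip: b_def)
    qed
    moreover have "fst (demazure y z) * t' = b * weyl_refl \<alpha>" if "t' \<in> LP (demazure y z)" for t'
      using LPE'[OF that] fst_yz fst_eq b' by metis
    ultimately have xyz': "(u, t) \<in> min_pairs x (demazure y z)"
      using LPI'[OF yz] Dxy(1) by (intro min_pairsI) metis+
    have "length_fun y (root_act v \<alpha>) = 0"
      using LP_reflected_iff[OF Dxy(2) \<alpha>] Dyz(1) v' by simp
    moreover define \<eta> where "\<eta> = cw_act (inverse v) (snd y)"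
    moreover have "pairing (root_act v \<alpha>) (snd y) = pairing \<alpha> \<eta>"
      using pairing_invariant[of v \<alpha> \<eta>] by (simp add: \<eta>_def flip: cw_act_mult)
    ultimately have pair: "pairing \<alpha> \<eta> = pos_ind (root_act b \<alpha>) - pos_ind (root_act v \<alpha>)"
      by (cases y) (simp add: b_def root_act_mult)
    have e1: "cw_act (inverse v') (snd y) = \<eta> - cw_scale (pairing \<alpha> \<eta>) (coroot \<alpha>)"
      using cw_act_weyl_refl[of \<alpha>] weyl_refl_involution(2)[OF \<alpha>]
      by (simp add: v' inverse_weyl_mult cw_act_mult reflection_def \<eta>_def del: weyl_refl_simps)
    have e2: "qbg_wt u (b * weyl_refl \<alpha>) = qbg_wt u b + cw_scale (1 - pos_ind (root_act b \<alpha>)) (coroot \<alpha>)"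
      by (rule qbg_wt_right[OF \<alpha> d1])
    have e3: "qbg_wt v c = qbg_wt v' c + cw_scale (1 - pos_ind (root_act v \<alpha>)) (coroot \<alpha>)"
      using qbg_wt_left[OF \<alpha>, of v' c] d2 pos_ind_simple_reflected[OF \<alpha>, of v] by (simp flip: v v')
    have "cw_act (inverse v) (snd y) - qbg_wt u (fst y * v) - qbg_wt v (fst z * t) =
        cw_act (inverse v') (snd y) - qbg_wt u (fst y * v') - qbg_wt v' (fst z * t)"
      unfolding b' e1 b_def[symmetric] c_def[symmetric] \<eta>_def[symmetric] e2 e3 pair cw_scale_diff_left
      by (simp add: algebra_simps)
    with xyz xyz' show ?thesis
      using demazure_assoc_common[OF _ _ _ xy yz] lev by simp
  qed
qed

theorem theorem1p4:
  shows "(\<forall>x\<in>W_T. \<forall>y\<in>W_T. lev x \<noteq> 0 \<longrightarrow> lev y \<noteq> 0 \<longrightarrow>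
            (\<exists>z\<in>W_T. demazure_values x y = {z})) \<and>
         (\<forall>x\<in>W_T. \<forall>y\<in>W_T. \<forall>z\<in>W_T. lev x > 1 \<longrightarrow> lev y > 1 \<longrightarrow> lev z > 1 \<longrightarrow>
            demazure (demazure x y) z = demazure x (demazure y z))"
proof (intro conjI ballI impI)
  fix x y assume "x \<in> W_T" "y \<in> W_T" "lev x \<noteq> 0" "lev y \<noteq> 0"
  then have lev: "lev x > 0" "lev y > 0" using W_T_lev by blast+
  then obtain u v where "(u, v) \<in> min_pairs x y" using min_pairs_nonempty by blast
  then have "demazure_values x y = {demazure_val x y u v}" by (rule demazure_eq(1)[OF lev])
  moreover have "demazure_val x y u v \<in> W_T" using lev by (intro W_T_iff) (simp add: lev_demazure_val)
  ultimately show "\<exists>z\<in>W_T. demazure_values x y = {z}" by blast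
qed (rule demazure_assoc)

end
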